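(* Let $\alpha_1,d_4,d_6$ be real constants with $d_4\neq0$ and $a:=1-2\alpha_1\neq0$, let $f_2(r)$ be a real function, and consider the Hamiltonian $$H=-\frac{\hbar^2}{2}\nabla^2+V_0+\frac12V_1(\vec\sigma_1+\vec\sigma_2,\vec L)+V_2(\vec\sigma_1,\vec\sigma_2)+V_3(\vec x,\vec\sigma_1)(\vec x,\vec\sigma_2)+V_4(\vec\sigma_1,\vec p)(\vec\sigma_2,\vec p)$$ with $$V_0=d_6+\frac{r^2f_2^2}{2d_4^2}-\frac{(1+2\alpha_1)\hbar}{4d_4}(3f_2+rf_2'),\qquad V_1=-\frac{2\alpha_1f_2}{d_4},$$ $$V_2=\frac{\hbar\left((1-6\alpha_1)f_2+(1-2\alpha_1)rf_2'\right)}{4d_4},\qquad V_3=\frac{2\alpha_1rf_2^2-d_4\hbar f_2'}{2d_4^2r},\qquad V_4=\alpha_1.$$ Let $K=(\vec\sigma_1,\vec\sigma_2)$ and let $$Y_P^{26}=\frac1a\left[(\vec\sigma_1-\vec\sigma_2,\vec p)+\frac{f_2(r)}{d_4}(\vec x,\vec\sigma_1\times\vec\sigma_2)\right],\qquad Y_P^{27}=f_2(r)(\vec\sigma_2-\vec\sigma_1,\vec x)+d_4(\vec\sigma_1\times\vec\sigma_2,\vec p).$$ Then $K,Y_P^{26},Y_P^{27}$ (which are integrals of motion of $H$) generate a finite polynomial symmetry algebra. Their non-trivial commutation relations are $$[K,Y_P^{26}]=\frac{4i}{a\,d_4}Y_P^{27},\qquad [K,Y_P^{27}]=-4id_4a\,Y_P^{26},\qquad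 [Y_P^{26},Y_P^{27}]=ia\,d_4(K+1)(Y_P^{26})^2.$$ Moreover, $(Y_P^{27})^2=d_4^2a^2(Y_P^{26})^2$.
   Context: $\vec x\in\mathbb R^3\setminus\{0\}$, $r=|\vec x|$, $p_k=-i\hbar\,\partial/\partial x_k$ with $\hbar>0$, $\vec L=\vec x\times\vec p$, $(\cdot,\cdot)$ is the Euclidean inner product; $\vec\sigma$ is the vector of Pauli matrices, $\vec\sigma_1=\vec\sigma\otimes I_2$, $\vec\sigma_2=I_2\otimes\vec\sigma$; a prime denotes $d/dr$. Operators act on smooth $\mathbb C^4$-valued functions on $\mathbb R^3\setminus\{0\}$ (radial functions are smooth); products are in the order written. An integral of motion is an operator commuting with $H$; a finite polynomial symmetry algebra is one generated by finitely many integrals of motion whose pairwise commutators are polynomials in the generators. *)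

theory Defs
  imports "HOL-Analysis.Analysis" "HOL-Library.Function_Algebras"
begin

text \<open>
  Smoothness on an open set: all iterated directional derivatives exist and are continuous.
\<close>

primrec Ck_on :: "nat \<Rightarrow> 'a set \<Rightarrow> ('a::real_normed_vector \<Rightarrow> 'b::real_normed_vector) \<Rightarrow> bool" where
  "Ck_on 0 S f \<longleftrightarrow> continuous_on S f"
| "Ck_on (Suc n) S f \<longleftrightarrow>
     (\<forall>x\<in>S. f differentiable (at x)) \<and> (\<forall>v. Ck_on n S (\<lambda>x. frechet_derivative f (at x) v))"

definition smooth_on :: "'a set \<Rightarrow> ('a::real_normed_vector \<Rightarrow> 'b::real_normed_vector) \<Rightarrow> bool" where
  "smooth_on S f \<longleftrightarrow> (\<forall>n. Ck_on n S f)"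

text \<open>
  The spin space is the tensor product $\mathbb{C}^2 \otimes \mathbb{C}^2 = \mathbb{C}^4$, with components indexed by
  pairs. A function on $\mathbb{R}^3 \setminus \{0\}$ is represented by a total function whose value
  at the origin is irrelevant; accordingly two operators are identified (\<open>op_eq\<close>) when they agree
  on smooth functions away from the origin. Sums, differences and the zero of operators are the
  pointwise ones, products are compositions.
\<close>

type_synonym spinor = "complex ^ (2 \<times> 2)"
type_synonym spin_matrix = "spinor ^ (2 \<times> 2)"
type_synonym spin_field = "real ^ 3 \<Rightarrow> spinor"
type_synonym spin_op = "spin_field \<Rightarrow> spin_field"

text \<open>The notation \<open>\<circ>\<close> binds weaker than \<open>+\<close>; products of operators need the opposite.\<close>

abbreviation op_mult :: "spin_op \<Rightarrow> spin_op \<Rightarrow> spin_op" (infixl \<open>\<odot>\<close> 70) where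
  "A \<odot> B \<equiv> A \<circ> B"

definition smooth_fields :: "spin_field set" where
  "smooth_fields = {\<psi>. smooth_on (- {0}) \<psi>}"

definition field_eq :: "spin_field \<Rightarrow> spin_field \<Rightarrow> bool" where
  "field_eq \<psi> \<phi> \<longleftrightarrow> (\<forall>x. x \<noteq> 0 \<longrightarrow> \<psi> x = \<phi> x)"

definition op_eq :: "spin_op \<Rightarrow> spin_op \<Rightarrow> bool" where
  "op_eq A B \<longleftrightarrow> (\<forall>\<psi>\<in>smooth_fields. field_eq (A \<psi>) (B \<psi>))"

definition op_scale :: "complex \<Rightarrow> spin_op \<Rightarrow> spin_op" where
  "op_scale c A = (\<lambda>\<psi> x. c *s A \<psi> x)"

definition op_comm :: "spin_op \<Rightarrow> spin_op \<Rightarrow> spin_op" where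
  "op_comm A B = A \<odot> B - B \<odot> A"

text \<open>
  Linear operators on the smooth functions on $\mathbb{R}^3 \setminus \{0\}$; the second clause says
  that the result does not depend on the irrelevant value at the origin.
\<close>

definition is_operator :: "spin_op \<Rightarrow> bool" where
  "is_operator A \<longleftrightarrow>
     (\<forall>\<psi>\<in>smooth_fields. A \<psi> \<in> smooth_fields) \<and>
     (\<forall>\<psi>\<in>smooth_fields. \<forall>\<phi>\<in>smooth_fields. field_eq \<psi> \<phi> \<longrightarrow> field_eq (A \<psi>) (A \<phi>)) \<and>
     (\<forall>\<psi>\<in>smooth_fields. \<forall>\<phi>\<in>smooth_fields. \<forall>c d.
        field_eq (A (\<lambda>x. c *s \<psi> x + d *s \<phi> x)) (\<lambda>x. c *s A \<psi> x + d *s A \<phi> x))"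

definition integral_of_motion :: "spin_op \<Rightarrow> spin_op \<Rightarrow> bool" where
  "integral_of_motion H A \<longleftrightarrow> is_operator A \<and> op_eq (op_comm H A) 0"

text \<open>Noncommutative polynomials, with complex coefficients, in the operators in \<open>G\<close>.\<close>

inductive_set op_polynomials :: "spin_op set \<Rightarrow> spin_op set" for G :: "spin_op set" where
  one: "id \<in> op_polynomials G"
| gen: "A \<in> G \<Longrightarrow> A \<in> op_polynomials G"
| scale: "A \<in> op_polynomials G \<Longrightarrow> op_scale c A \<in> op_polynomials G"
| add: "A \<in> op_polynomials G \<Longrightarrow> B \<in> op_polynomials G \<Longrightarrow> A + B \<in> op_polynomials G"
| mult: "A \<in> op_polynomials G \<Longrightarrow> B \<in> op_polynomials G \<Longrightarrow> A \<odot> B \<in> op_polynomials G"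

definition generate_polynomial_symmetry_algebra :: "spin_op \<Rightarrow> spin_op set \<Rightarrow> bool" where
  "generate_polynomial_symmetry_algebra H G \<longleftrightarrow>
     finite G \<and> (\<forall>A\<in>G. integral_of_motion H A) \<and>
     (\<forall>A\<in>G. \<forall>B\<in>G. \<exists>P\<in>op_polynomials G. op_eq (op_comm A B) P)"

text \<open>
  Triples of operators. Arithmetic on the index type \<open>3\<close> is modulo 3, so the cross product is
  given by the cyclic formula $(A \times B)_k = A_{k+1} B_{k+2} - A_{k+2} B_{k+1}$.
\<close>

type_synonym op_vec = "3 \<Rightarrow> spin_op"

definition op_dot :: "op_vec \<Rightarrow> op_vec \<Rightarrow> spin_op" where
  "op_dot A B = (\<Sum>k\<in>UNIV. A k \<odot> B k)"

definition op_cross :: "op_vec \<Rightarrow> op_vec \<Rightarrow> op_vec" where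
  "op_cross A B = (\<lambda>k. A (k + 1) \<odot> B (k + 2) - A (k + 2) \<odot> B (k + 1))"

definition radial_op :: "(real \<Rightarrow> real) \<Rightarrow> spin_op" where
  "radial_op g = (\<lambda>\<psi> x. complex_of_real (g (norm x)) *s \<psi> x)"

definition position_op :: op_vec where
  "position_op k = (\<lambda>\<psi> x. complex_of_real (x $ k) *s \<psi> x)"

definition partial_op :: op_vec where
  "partial_op k = (\<lambda>\<psi> x. frechet_derivative \<psi> (at x) (axis k 1))"

definition laplace_op :: spin_op where
  "laplace_op = op_dot partial_op partial_op"

definition momentum_op :: "real \<Rightarrow> op_vec" where
  "momentum_op hbar k = op_scale (- \<i> * complex_of_real hbar) (partial_op k)"

definition angular_momentum_op :: "real \<Rightarrow> op_vec" where
  "angular_momentum_op hbar = op_cross position_op (momentum_op hbar)"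

definition pauli :: "3 \<Rightarrow> complex ^ 2 ^ 2" where
  "pauli k =
     (if k = 1 then vector [vector [0, 1], vector [1, 0]]
      else if k = 2 then vector [vector [0, - \<i>], vector [\<i>, 0]]
      else vector [vector [1, 0], vector [0, - 1]])"

definition kronecker :: "complex ^ 2 ^ 2 \<Rightarrow> complex ^ 2 ^ 2 \<Rightarrow> spin_matrix" where
  "kronecker A B = (\<chi> i j. A $ fst i $ fst j * B $ snd i $ snd j)"

definition matrix_op :: "spin_matrix \<Rightarrow> spin_op" where
  "matrix_op M = (\<lambda>\<psi> x. M *v \<psi> x)"

definition sigma1 :: op_vec where
  "sigma1 k = matrix_op (kronecker (pauli k) (mat 1))"

definition sigma2 :: op_vec where
  "sigma2 k = matrix_op (kronecker (mat 1) (pauli k))"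

definition hamiltonian ::
  "real \<Rightarrow> (real \<Rightarrow> real) \<Rightarrow> (real \<Rightarrow> real) \<Rightarrow> (real \<Rightarrow> real) \<Rightarrow> (real \<Rightarrow> real) \<Rightarrow> (real \<Rightarrow> real) \<Rightarrow> spin_op"
where
  "hamiltonian hbar V0 V1 V2 V3 V4 =
     op_scale (- (complex_of_real (hbar\<^sup>2) / 2)) laplace_op
     + radial_op V0
     + op_scale (1 / 2) (radial_op V1 \<odot> op_dot (sigma1 + sigma2) (angular_momentum_op hbar))
     + radial_op V2 \<odot> op_dot sigma1 sigma2
     + radial_op V3 \<odot> op_dot position_op sigma1 \<odot> op_dot position_op sigma2
     + radial_op V4 \<odot> op_dot sigma1 (momentum_op hbar) \<odot> op_dot sigma2 (momentum_op hbar)"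

end

theory Submission
  imports Defs
begin

text \<open>
  Split a spinor into its singlet part $s$ and its triplet part $\vec t$ (a vector in a Cartesian
  basis), and put $g = f_2 / d_4$, $\vec\pi = \vec p - i g \vec x$, $\vec\pi^* = \vec p + i g \vec x$. Since
  $g$ is radial, the components of $\vec\pi$ commute with each other, and so do those of $\vec\pi^*$.
  In these terms $K$ is $- 3$ on singlets and $1$ on triplets, both integrals are of the form
  $(s, \vec t) \mapsto (c\, \vec\pi^* \cdot \vec t,\; d\, \vec\pi s)$ with constants $c, d$, and
  \[ H s = d_6 s + \frac a2\, \vec\pi^* \cdot \vec\pi s, \qquad
     H t_k = d_6 t_k + \frac a2\, \pi_k (\vec\pi^* \cdot \vec t)
       + \frac{1 + 2 \alpha_1}2 \sum_j \pi^*_j (\pi_j t_k - \pi_k t_j). \]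
  The curl term is annihilated by $\vec\pi^* \cdot {}$ and annihilates gradients $\vec\pi s$, so $H$
  commutes with both integrals; the remaining relations only involve the constants $c, d$.
\<close>

subsection \<open>Smooth functions on open sets\<close>

text \<open>On an open set the derivative at a point only sees nearby values, so agreement on the
  set is inherited by all iterated derivatives.\<close>

lemma Ck_on_cong:
  assumes "open S" "\<And>x. x \<in> S \<Longrightarrow> f x = g x"
  shows "Ck_on n S f \<longleftrightarrow> Ck_on n S g"
  using assms(2)
proof (induction n arbitrary: f g)
  case 0
  then show ?case by (simp cong: continuous_on_cong)
next
  case (Suc n)
  have "f differentiable (at x) \<longleftrightarrow> g differentiable (at x)" if "x \<in> S" for x
    using Suc.prems that assms(1)
      has_derivative_transform_within_open[of f _ x UNIV S g]
      has_derivative_transform_within_open[of g _ x UNIV S f]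
    by (auto simp: differentiable_def)
  moreover have "frechet_derivative f (at x) = frechet_derivative g (at x)"
    if "x \<in> S" "f differentiable (at x)" for x
    using Suc.prems that assms(1) by (intro frechet_derivative_transform_within_open)
  ultimately show ?case
    by (simp cong: ball_cong) (metis (no_types, lifting) Suc.IH)
qed

lemma Ck_on_SucD: "Ck_on (Suc n) S f \<Longrightarrow> Ck_on n S f"
proof (induction n arbitrary: f)
  case 0
  then show ?case
    by (auto intro!: continuous_at_imp_continuous_on differentiable_imp_continuous_within)
next
  case (Suc n)
  then show ?case by (metis Ck_on.simps(2))
qed

text \<open>Allows any known derivative formula in place of \<open>frechet_derivative\<close>; the
  inductions below go through this rule.\<close>

lemma Ck_on_SucI:
  assumes "open S" "\<And>x. x \<in> S \<Longrightarrow> (f has_derivative f' x) (at x)"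
    and "\<And>v. Ck_on n S (\<lambda>x. f' x v)"
  shows "Ck_on (Suc n) S f"
proof -
  have "frechet_derivative f (at x) = f' x" if "x \<in> S" for x
    using assms(2)[OF that] frechet_derivative_at by metis
  with assms show ?thesis
    by (auto simp: differentiable_def cong: Ck_on_cong)
qed

lemma Ck_on_has_derivative:
  "Ck_on (Suc n) S f \<Longrightarrow> x \<in> S \<Longrightarrow> (f has_derivative frechet_derivative f (at x)) (at x)"
  by (simp add: frechet_derivative_works[symmetric])

lemma Ck_on_const: "open S \<Longrightarrow> Ck_on n S (\<lambda>x. c)"
proof (induction n arbitrary: c)
  case (Suc n)
  show ?case by (rule Ck_on_SucI[where f' = "\<lambda>_ _. 0"]) (use Suc in auto)
qed simp

lemma Ck_on_bounded_linear:
  assumes "open S" "bounded_linear L"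
  shows "Ck_on n S L"
proof (cases n)
  case 0
  with assms show ?thesis by (simp add: linear_continuous_on)
next
  case (Suc m)
  show ?thesis unfolding Suc
    by (rule Ck_on_SucI[where f' = "\<lambda>_. L"])
      (use assms Ck_on_const in \<open>auto intro: bounded_linear_imp_has_derivative\<close>)
qed

lemma Ck_on_bounded_linear_compose:
  assumes "open S" "bounded_linear L" "Ck_on n S f"
  shows "Ck_on n S (\<lambda>x. L (f x))"
  using assms(3)
proof (induction n arbitrary: f)
  case 0
  then show ?case using assms(2) by (simp add: bounded_linear.continuous_on)
next
  case (Suc n)
  show ?case
  proof (rule Ck_on_SucI)
    show "((\<lambda>x. L (f x)) has_derivative (\<lambda>v. L (frechet_derivative f (at x) v))) (at x)"
      if "x \<in> S" for x
      using Ck_on_has_derivative[OF Suc.prems that] assms(2)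
      by (rule bounded_linear.has_derivative[rotated])
    show "Ck_on n S (\<lambda>x. L (frechet_derivative f (at x) v))" for v
      using Suc by simp
  qed fact
qed

lemma Ck_on_add:
  assumes "open S" "Ck_on n S f" "Ck_on n S g"
  shows "Ck_on n S (\<lambda>x. f x + g x)"
  using assms(2,3)
proof (induction n arbitrary: f g)
  case 0
  then show ?case by (simp add: continuous_on_add)
next
  case (Suc n)
  show ?case
  proof (rule Ck_on_SucI)
    show "((\<lambda>x. f x + g x) has_derivative
        (\<lambda>v. frechet_derivative f (at x) v + frechet_derivative g (at x) v)) (at x)"
      if "x \<in> S" for x
      using Suc.prems that by (intro has_derivative_add Ck_on_has_derivative)
  qed (use Suc assms(1) in auto)
qed

text \<open>The product rule turns the derivative into a sum of two products of the same kind. In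
  each, one factor is a derivative and the other is lowered by one order with
  \<open>Ck_on_SucD\<close>, so the induction hypothesis covers both.\<close>

lemma Ck_on_bounded_bilinear:
  assumes "open S" "bounded_bilinear p" "Ck_on n S f" "Ck_on n S g"
  shows "Ck_on n S (\<lambda>x. p (f x) (g x))"
  using assms(3,4)
proof (induction n arbitrary: f g)
  case 0
  then show ?case using bounded_bilinear.continuous_on[OF assms(2)] by simp
next
  case (Suc n)
  show ?case
  proof (rule Ck_on_SucI)
    show "((\<lambda>x. p (f x) (g x)) has_derivative
        (\<lambda>v. p (f x) (frechet_derivative g (at x) v)
          + p (frechet_derivative f (at x) v) (g x))) (at x)"
      if "x \<in> S" for x
      using Suc.prems that by (intro bounded_bilinear.FDERIV[OF assms(2)] Ck_on_has_derivative)
    show "Ck_on n S (\<lambda>x. p (f x) (frechet_derivative g (at x) v)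
        + p (frechet_derivative f (at x) v) (g x))" for v
      using Suc Ck_on_SucD[OF Suc.prems(1)] Ck_on_SucD[OF Suc.prems(2)] assms(1)
      by (intro Ck_on_add Suc.IH) auto
  qed fact
qed

section \<open>Closure properties of smooth functions\<close>

lemma smooth_on_cong:
  "open S \<Longrightarrow> (\<And>x. x \<in> S \<Longrightarrow> f x = g x) \<Longrightarrow> smooth_on S f \<longleftrightarrow> smooth_on S g"
  unfolding smooth_on_def using Ck_on_cong by blast

lemma smooth_on_has_derivative:
  "smooth_on S f \<Longrightarrow> x \<in> S \<Longrightarrow> (f has_derivative frechet_derivative f (at x)) (at x)"
  unfolding smooth_on_def using Ck_on_has_derivative by blast

lemma smooth_on_imp_continuous_on: "smooth_on S f \<Longrightarrow> continuous_on S f"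
  unfolding smooth_on_def by (metis Ck_on.simps(1))

lemma smooth_on_frechet_derivative:
  "smooth_on S f \<Longrightarrow> smooth_on S (\<lambda>x. frechet_derivative f (at x) v)"
  unfolding smooth_on_def by (metis Ck_on.simps(2))

lemma Ck_on_subset: "Ck_on n T f \<Longrightarrow> S \<subseteq> T \<Longrightarrow> Ck_on n S f"
  by (induction n arbitrary: f) (auto intro: continuous_on_subset)

lemma smooth_on_subset: "smooth_on T f \<Longrightarrow> S \<subseteq> T \<Longrightarrow> smooth_on S f"
  unfolding smooth_on_def using Ck_on_subset by blast

lemma smooth_on_const: "open S \<Longrightarrow> smooth_on S (\<lambda>x. c)"
  by (simp add: smooth_on_def Ck_on_const)

lemma smooth_on_bounded_linear: "open S \<Longrightarrow> bounded_linear L \<Longrightarrow> smooth_on S L"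
  by (simp add: smooth_on_def Ck_on_bounded_linear)

lemma smooth_on_bounded_linear_compose:
  "open S \<Longrightarrow> bounded_linear L \<Longrightarrow> smooth_on S f \<Longrightarrow> smooth_on S (\<lambda>x. L (f x))"
  by (simp add: smooth_on_def Ck_on_bounded_linear_compose)

lemma smooth_on_add:
  "open S \<Longrightarrow> smooth_on S f \<Longrightarrow> smooth_on S g \<Longrightarrow> smooth_on S (\<lambda>x. f x + g x)"
  by (simp add: smooth_on_def Ck_on_add)

lemma smooth_on_mult:
  fixes f g :: "'a::real_normed_vector \<Rightarrow> 'b::real_normed_algebra"
  shows "open S \<Longrightarrow> smooth_on S f \<Longrightarrow> smooth_on S g \<Longrightarrow> smooth_on S (\<lambda>x. f x * g x)"
  by (simp add: smooth_on_def Ck_on_bounded_bilinear[OF _ bounded_bilinear_mult])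

lemma smooth_on_sum:
  assumes "open S" "finite I" "\<And>i. i \<in> I \<Longrightarrow> smooth_on S (f i)"
  shows "smooth_on S (\<lambda>x. \<Sum>i\<in>I. f i x)"
  using assms(2,3)
  by (induction) (auto intro!: smooth_on_const smooth_on_add assms(1))

text \<open>The derivative of 1/x is -1/x^2, a product of the function with itself, so order n
  yields order n + 1.\<close>

lemma smooth_on_inverse: "smooth_on {0<..} (inverse :: real \<Rightarrow> real)"
proof -
  have "Ck_on n {0<..} (inverse :: real \<Rightarrow> real)" for n
  proof (induction n)
    case 0
    show ?case by (auto intro!: continuous_intros)
  next
    case (Suc n)
    show ?case
    proof (rule Ck_on_SucI)
      show "(inverse has_derivative (\<lambda>v. - (inverse x * v * inverse x))) (at x)"
        if "x \<in> {0<..}" for x :: real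
        using that by (intro has_derivative_inverse') auto
      have "Ck_on n {0<..} (\<lambda>x. (- v) * (inverse x * inverse x))" for v :: real
        by (intro Ck_on_bounded_bilinear[OF _ bounded_bilinear_mult] Ck_on_const Suc) auto
      then show "Ck_on n {0<..} (\<lambda>x. - (inverse x * v * inverse x))" for v :: real
        by (simp add: algebra_simps)
    qed simp
  qed
  then show ?thesis by (simp add: smooth_on_def)
qed

section \<open>Functions of one real variable and radial functions\<close>

lemma frechet_derivative_real:
  fixes f :: "real \<Rightarrow> real"
  assumes "f differentiable (at x)"
  shows "(f has_field_derivative deriv f x) (at x)"
    and "frechet_derivative f (at x) = (*) (deriv f x)"
proof -
  show *: "(f has_field_derivative deriv f x) (at x)"
    using assms by (metis DERIV_deriv_iff_real_differentiable)
  show "frechet_derivative f (at x) = (*) (deriv f x)"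
    using * unfolding has_field_derivative_def by (metis frechet_derivative_at)
qed

lemma smooth_on_deriv:
  fixes f :: "real \<Rightarrow> real"
  assumes "open S" "smooth_on S f"
  shows "smooth_on S (deriv f)"
proof -
  have "smooth_on S (\<lambda>x. frechet_derivative f (at x) 1)"
    using assms by (intro smooth_on_frechet_derivative)
  also have "?this \<longleftrightarrow> ?thesis"
    using assms by (intro smooth_on_cong)
      (auto simp: frechet_derivative_real(2)[OF differentiableI] dest: smooth_on_has_derivative)
  finally show ?thesis .
qed

text \<open>Chain rule with grad |x| = x / |x|. The factor 1/|x| is grouped with g', so that the
  coefficient of the linear form is again radial.\<close>

lemma has_derivative_radial:
  fixes x :: "'a::real_inner"
  assumes "smooth_on {0<..} g" "x \<noteq> 0"
  shows "((\<lambda>x. g (norm x)) has_derivative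
    (\<lambda>v. deriv g (norm x) * inverse (norm x) * (x \<bullet> v))) (at x)"
proof -
  have "(g has_derivative (*) (deriv g (norm x))) (at (norm x))"
    using smooth_on_has_derivative[OF assms(1), of "norm x"] assms(2)
    by (metis differentiableI frechet_derivative_real(2) greaterThan_iff zero_less_norm_iff)
  moreover have "(norm has_derivative (\<lambda>v. v \<bullet> sgn x)) (at x)"
    using assms(2) by (rule has_derivative_norm)
  ultimately have "(g \<circ> norm has_derivative (*) (deriv g (norm x)) \<circ> (\<lambda>v. v \<bullet> sgn x)) (at x)"
    by (intro diff_chain_at)
  then show ?thesis
    by (simp add: o_def sgn_div_norm inner_commute mult.assoc)
qed

text \<open>A directional derivative of a radial function is the radial function of g'(r)/r times a
  linear form. The profile changes at each order, hence the induction over arbitrary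
  \<open>g\<close>.\<close>

lemma smooth_on_radial:
  fixes g :: "real \<Rightarrow> real"
  assumes "smooth_on {0<..} g"
  shows "smooth_on (- {0::'a::real_inner}) (\<lambda>x. g (norm x))"
proof -
  have "Ck_on n (- {0::'a}) (\<lambda>x. g (norm x))" for n
    using assms
  proof (induction n arbitrary: g)
    case 0
    then have "continuous_on (norm ` (- {0::'a})) g"
      by (auto intro: continuous_on_subset dest: smooth_on_imp_continuous_on)
    then show ?case
      by (simp add: continuous_on_compose2[OF _ continuous_on_norm_id])
  next
    case (Suc n)
    show ?case
    proof (rule Ck_on_SucI)
      show "((\<lambda>x. g (norm x)) has_derivative
          (\<lambda>v. deriv g (norm x) * inverse (norm x) * (x \<bullet> v))) (at x)" if "x \<in> - {0}" for x :: 'a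
        using Suc.prems that by (intro has_derivative_radial) auto
      show "Ck_on n (- {0}) (\<lambda>x::'a. deriv g (norm x) * inverse (norm x) * (x \<bullet> v))" for v
        using Suc.prems
        by (intro Ck_on_bounded_bilinear[OF _ bounded_bilinear_mult] Ck_on_bounded_linear
            bounded_linear_inner_left Suc.IH[where g = "\<lambda>r. deriv g r * inverse r"]
            smooth_on_mult smooth_on_deriv smooth_on_inverse) auto
    qed auto
  qed
  then show ?thesis by (simp add: smooth_on_def)
qed

lemma frechet_derivative_bounded_linear_compose:
  assumes "bounded_linear L" "f differentiable (at x)"
  shows "frechet_derivative (\<lambda>x. L (f x)) (at x) v = L (frechet_derivative f (at x) v)"
  using bounded_linear.has_derivative[OF assms(1)] assms(2)
  by (metis frechet_derivative_at frechet_derivative_works)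

subsection \<open>Equality of mixed partial derivatives\<close>

text \<open>The mean value theorem is applied twice, first along \<open>v\<close> and then along
  \<open>w\<close>; the bound keeps the whole parallelogram inside the ball. The second difference
  is symmetric in \<open>v\<close> and \<open>w\<close>, which gives the symmetry of second
  derivatives.\<close>

lemma second_difference_mean_value:
  fixes f :: "'a::real_normed_vector \<Rightarrow> real"
  assumes f: "smooth_on (ball x e) f" and t: "0 < t" and te: "t * (norm v + norm w) < e"
  obtains y where "norm (y - x) \<le> t * (norm v + norm w)"
    and "f (x + t *\<^sub>R v + t *\<^sub>R w) - f (x + t *\<^sub>R v) - f (x + t *\<^sub>R w) + f x
      = t * t * frechet_derivative (\<lambda>x. frechet_derivative f (at x) v) (at y) w"
proof -
  define f' where "f' = (\<lambda>x. frechet_derivative f (at x) v)"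
  have f': "smooth_on (ball x e) f'"
    unfolding f'_def by (rule smooth_on_frechet_derivative[OF f])
  have bound: "norm (r *\<^sub>R v + s *\<^sub>R w) \<le> t * (norm v + norm w)"
    if "0 \<le> r" "r \<le> t" "0 \<le> s" "s \<le> t" for r s
  proof -
    have "norm (r *\<^sub>R v + s *\<^sub>R w) \<le> r * norm v + s * norm w"
      using norm_triangle_ineq[of "r *\<^sub>R v" "s *\<^sub>R w"] that by simp
    also have "\<dots> \<le> t * norm v + t * norm w"
      using that by (intro add_mono mult_right_mono) auto
    finally show ?thesis by (simp add: algebra_simps)
  qed
  have inball: "x + (r *\<^sub>R v + s *\<^sub>R w) \<in> ball x e"
    if "0 \<le> r" "r \<le> t" "0 \<le> s" "s \<le> t" for r s
  proof -
    have "dist x (x + u) = norm u" for u by (simp add: dist_norm)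
    then show ?thesis using bound[OF that] te by (simp only: mem_ball)
  qed
  have line: "((\<lambda>r. h (z + r *\<^sub>R u)) has_derivative
      (\<lambda>d. d * frechet_derivative h (at (z + r *\<^sub>R u)) u)) (at r)"
    if "smooth_on (ball x e) h" "z + r *\<^sub>R u \<in> ball x e" for h :: "'a \<Rightarrow> real" and z u r
  proof -
    have "((\<lambda>r. z + r *\<^sub>R u) has_derivative (\<lambda>d. d *\<^sub>R u)) (at r)"
      by (auto intro!: derivative_eq_intros)
    from diff_chain_at[OF this smooth_on_has_derivative[OF that]]
    have "((\<lambda>r. h (z + r *\<^sub>R u)) has_derivative
        (\<lambda>d. frechet_derivative h (at (z + r *\<^sub>R u)) (d *\<^sub>R u))) (at r)"
      by (simp add: o_def)
    then show ?thesis
      using linear_frechet_derivative[OF differentiableI[OF smooth_on_has_derivative[OF that]]]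
      by (simp add: linear_cmul)
  qed
  \<comment> \<open>The increment of this function from 0 to \<open>t\<close> is the second
    difference.\<close>
  define \<phi> where "\<phi> = (\<lambda>r. f ((x + t *\<^sub>R w) + r *\<^sub>R v) - f (x + r *\<^sub>R v))"
  have "\<exists>r. 0 < r \<and> r < t \<and> \<phi> t - \<phi> 0
      = (t - 0) * (f' ((x + t *\<^sub>R w) + r *\<^sub>R v) - f' (x + r *\<^sub>R v))"
  proof (rule MVT2[OF t])
    fix r :: real assume r: "0 \<le> r" "r \<le> t"
    have "(\<phi> has_derivative (\<lambda>d. d * f' ((x + t *\<^sub>R w) + r *\<^sub>R v) - d * f' (x + r *\<^sub>R v))) (at r)"
      unfolding \<phi>_def f'_def
      using inball[of r t] inball[of r 0] r t
      by (intro has_derivative_diff line f) (auto simp: algebra_simps)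
    then show "(\<phi> has_field_derivative f' ((x + t *\<^sub>R w) + r *\<^sub>R v) - f' (x + r *\<^sub>R v)) (at r)"
      unfolding has_field_derivative_def by (rule has_derivative_eq_rhs) (auto simp: algebra_simps)
  qed
  then obtain r where r: "0 < r" "r < t"
    and \<phi>: "\<phi> t - \<phi> 0 = t * (f' ((x + t *\<^sub>R w) + r *\<^sub>R v) - f' (x + r *\<^sub>R v))"
    by auto
  have "\<exists>s. 0 < s \<and> s < t \<and> f' ((x + r *\<^sub>R v) + t *\<^sub>R w) - f' ((x + r *\<^sub>R v) + 0 *\<^sub>R w)
    = (t - 0) * frechet_derivative f' (at ((x + r *\<^sub>R v) + s *\<^sub>R w)) w"
  proof (rule MVT2[OF t])
    fix s :: real assume s: "0 \<le> s" "s \<le> t"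
    from line[OF f' inball[of r s, folded add.assoc]] r s
    show "((\<lambda>s. f' ((x + r *\<^sub>R v) + s *\<^sub>R w)) has_field_derivative
        frechet_derivative f' (at ((x + r *\<^sub>R v) + s *\<^sub>R w)) w) (at s)"
      unfolding has_field_derivative_def by (simp add: mult_commute_abs)
  qed
  then obtain s where s: "0 < s" "s < t"
    and f'_diff: "f' ((x + r *\<^sub>R v) + t *\<^sub>R w) - f' (x + r *\<^sub>R v)
      = t * frechet_derivative f' (at ((x + r *\<^sub>R v) + s *\<^sub>R w)) w"
    by auto
  show ?thesis
  proof (rule that[of "(x + r *\<^sub>R v) + s *\<^sub>R w"])
    show "norm ((x + r *\<^sub>R v) + s *\<^sub>R w - x) \<le> t * (norm v + norm w)"
      using bound[of r s] r s by (simp add: add.assoc)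
    show "f (x + t *\<^sub>R v + t *\<^sub>R w) - f (x + t *\<^sub>R v) - f (x + t *\<^sub>R w) + f x
      = t * t * frechet_derivative (\<lambda>x. frechet_derivative f (at x) v)
          (at ((x + r *\<^sub>R v) + s *\<^sub>R w)) w"
      using \<phi> f'_diff unfolding \<phi>_def f'_def[symmetric]
      by (simp add: add.commute add.left_commute mult.assoc)
  qed
qed

lemma isCont_real_epsE:
  fixes f :: "'a::metric_space \<Rightarrow> real"
  assumes "isCont f x" "\<epsilon> > 0"
  obtains d where "d > 0" "\<And>y. dist y x < d \<Longrightarrow> \<bar>f y - f x\<bar> < \<epsilon>"
  using assms unfolding continuous_at_eps_delta dist_real_def by blast

text \<open>Both mixed derivatives, taken at suitable points near \<open>x\<close>, equal the same
  second difference divided by t^2. Continuity carries this equality to \<open>x\<close>.\<close>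

lemma frechet_derivative_commute_real:
  fixes f :: "'a::real_normed_vector \<Rightarrow> real"
  assumes "open S" "smooth_on S f" "x \<in> S"
  shows "frechet_derivative (\<lambda>x. frechet_derivative f (at x) v) (at x) w
       = frechet_derivative (\<lambda>x. frechet_derivative f (at x) w) (at x) v"
    (is "?F x = ?G x")
proof -
  obtain e where e: "e > 0" "ball x e \<subseteq> S"
    using assms(1,3) openE by blast
  then have f: "smooth_on (ball x e) f"
    using assms(2) smooth_on_subset by blast
  have "\<bar>?F x - ?G x\<bar> \<le> 2 * \<epsilon>" if eps: "\<epsilon> > 0" for \<epsilon>
  proof -
    have cont: "isCont ?F x" "isCont ?G x"
      using smooth_on_imp_continuous_on[OF
          smooth_on_frechet_derivative[OF smooth_on_frechet_derivative[OF f]]] e(1)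
      by (simp_all add: continuous_on_eq_continuous_at)
    obtain d1 where d1: "d1 > 0" "\<And>y. dist y x < d1 \<Longrightarrow> \<bar>?F y - ?F x\<bar> < \<epsilon>"
      using isCont_real_epsE[OF cont(1) eps] by blast
    obtain d2 where d2: "d2 > 0" "\<And>y. dist y x < d2 \<Longrightarrow> \<bar>?G y - ?G x\<bar> < \<epsilon>"
      using isCont_real_epsE[OF cont(2) eps] by blast
    \<comment> \<open>\<open>m\<close> is within all three radii; dividing by \<open>N + 1\<close>
      avoids division by zero and makes \<open>t * N < m\<close> strict.\<close>
    define N where "N = norm v + norm w"
    define m where "m = min e (min d1 d2)"
    define t where "t = m / (N + 1)"
    have m: "m > 0" "m \<le> e" "m \<le> d1" "m \<le> d2" and N: "N \<ge> 0"
      using e(1) d1(1) d2(1) by (auto simp: m_def N_def)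
    then have t: "t > 0" "t * N < m"
      by (auto simp: t_def field_simps)
    obtain y where y: "norm (y - x) \<le> t * N"
      "f (x + t *\<^sub>R v + t *\<^sub>R w) - f (x + t *\<^sub>R v) - f (x + t *\<^sub>R w) + f x = t * t * ?F y"
      using second_difference_mean_value[OF f t(1), of v w] t(2) m(2) unfolding N_def by auto
    obtain z where z: "norm (z - x) \<le> t * N"
      "f (x + t *\<^sub>R w + t *\<^sub>R v) - f (x + t *\<^sub>R w) - f (x + t *\<^sub>R v) + f x = t * t * ?G z"
      using second_difference_mean_value[OF f t(1), of w v] t(2) m(2)
      unfolding N_def by (auto simp: add.commute)
    have "t * t * ?F y = t * t * ?G z"
      using y(2) z(2) by (simp add: algebra_simps)
    then have "?F y = ?G z" using t(1) by simp
    then show ?thesis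
      using d1(2)[of y] d2(2)[of z] y(1) z(1) t(2) m by (auto simp: dist_norm)
  qed
  then have "\<bar>?F x - ?G x\<bar> \<le> \<epsilon>" if "\<epsilon> > 0" for \<epsilon>
    using that by (metis field_sum_of_halves half_gt_zero mult_2)
  then show ?thesis
    using field_le_epsilon[of "\<bar>?F x - ?G x\<bar>" 0] by simp
qed

text \<open>Pairing with a fixed vector \<open>c\<close> commutes with differentiation and reduces
  the claim to real functions; these pairings separate vectors.\<close>

lemma frechet_derivative_commute:
  fixes f :: "'a::real_normed_vector \<Rightarrow> 'b::real_inner"
  assumes "open S" "smooth_on S f" "x \<in> S"
  shows "frechet_derivative (\<lambda>x. frechet_derivative f (at x) v) (at x) w
       = frechet_derivative (\<lambda>x. frechet_derivative f (at x) w) (at x) v"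
proof -
  have inner: "frechet_derivative (\<lambda>x. c \<bullet> h x) (at y) u = c \<bullet> frechet_derivative h (at y) u"
    if "smooth_on S h" "y \<in> S" for c h y u
    using that by (intro frechet_derivative_bounded_linear_compose bounded_linear_inner_right)
      (auto intro: differentiableI smooth_on_has_derivative)
  have inner2: "c \<bullet> frechet_derivative (\<lambda>x. frechet_derivative f (at x) v) (at x) w
      = frechet_derivative (\<lambda>x. frechet_derivative (\<lambda>x. c \<bullet> f x) (at x) v) (at x) w" for c v w
  proof -
    have "c \<bullet> frechet_derivative (\<lambda>x. frechet_derivative f (at x) v) (at x) w
      = frechet_derivative (\<lambda>x. c \<bullet> frechet_derivative f (at x) v) (at x) w"
      using assms by (simp add: inner smooth_on_frechet_derivative)
    \<comment> \<open>The pairing can be moved through the inner derivative at every point of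
      \<open>S\<close>, and the outer derivative depends only on a neighbourhood of
      \<open>x\<close>.\<close>
    also have "\<dots> = frechet_derivative (\<lambda>x. frechet_derivative (\<lambda>x. c \<bullet> f x) (at x) v) (at x) w"
    proof (rule arg_cong[where f = "\<lambda>d. d w"],
        rule frechet_derivative_transform_within_open[OF _ assms(1,3)])
      show "(\<lambda>x. c \<bullet> frechet_derivative f (at x) v) differentiable (at x)"
        using assms smooth_on_bounded_linear_compose[OF assms(1) bounded_linear_inner_right
            smooth_on_frechet_derivative[OF assms(2)]]
        by (blast intro: differentiableI smooth_on_has_derivative)
    qed (use assms in \<open>simp add: inner\<close>)
    finally show ?thesis .
  qed
  have "c \<bullet> frechet_derivative (\<lambda>x. frechet_derivative f (at x) v) (at x) w
      = c \<bullet> frechet_derivative (\<lambda>x. frechet_derivative f (at x) w) (at x) v" for c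
    unfolding inner2
    by (rule frechet_derivative_commute_real[OF assms(1) _ assms(3)])
      (rule smooth_on_bounded_linear_compose[OF assms(1) bounded_linear_inner_right assms(2)])
  then show ?thesis using vector_eq_ldot by blast
qed

subsection \<open>The differential ring of smooth functions off the origin\<close>

lemma open_punctured [simp]: "open (- {0 :: 'a::real_normed_vector})"
  by (simp add: open_Compl)

text \<open>Fixing the value 0 at the origin leaves one representative for each function off the
  origin. Equality off the origin thus becomes equality in a commutative ring, open to algebraic
  simplification.\<close>

typedef smooth_fun = "{f :: real ^ 3 \<Rightarrow> complex. smooth_on (- {0}) f \<and> f 0 = 0}"
  morphisms sval Smooth_fun
  by (rule exI[of _ "\<lambda>_. 0"]) (simp add: smooth_on_const)

setup_lifting type_definition_smooth_fun

lemma smooth_on_if_zero: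
  "smooth_on (- {0}) f \<Longrightarrow> smooth_on (- {0}) (\<lambda>x. if x = 0 then c else f x)"
  by (subst smooth_on_cong[where g = f]) auto

instantiation smooth_fun :: comm_ring_1
begin

lift_definition zero_smooth_fun :: smooth_fun is "\<lambda>_. 0"
  by (simp add: smooth_on_const)

lift_definition one_smooth_fun :: smooth_fun is "\<lambda>x. if x = 0 then 0 else 1"
  by (simp add: smooth_on_const smooth_on_if_zero)

lift_definition plus_smooth_fun :: "smooth_fun \<Rightarrow> smooth_fun \<Rightarrow> smooth_fun"
  is "\<lambda>f g x. f x + g x"
  by (simp add: smooth_on_add)

lift_definition uminus_smooth_fun :: "smooth_fun \<Rightarrow> smooth_fun" is "\<lambda>f x. - f x"
  by (simp add: smooth_on_bounded_linear_compose[OF _ bounded_linear_minus[OF bounded_linear_ident]])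

lift_definition minus_smooth_fun :: "smooth_fun \<Rightarrow> smooth_fun \<Rightarrow> smooth_fun"
  is "\<lambda>f g x. f x - g x"
  using smooth_on_add[OF open_punctured _
      smooth_on_bounded_linear_compose[OF open_punctured bounded_linear_minus[OF bounded_linear_ident]]]
  by fastforce

lift_definition times_smooth_fun :: "smooth_fun \<Rightarrow> smooth_fun \<Rightarrow> smooth_fun"
  is "\<lambda>f g x. f x * g x"
  by (simp add: smooth_on_mult)

instance
proof
  show "(0 :: smooth_fun) \<noteq> 1"
  proof transfer
    \<comment> \<open>The two functions agree at the origin, so a nonzero point has to be
      exhibited.\<close>
    have "(axis 1 1 :: real ^ 3) \<noteq> 0" by simp
    then show "(\<lambda>_. 0) \<noteq> (\<lambda>x :: real ^ 3. if x = 0 then 0 else 1 :: complex)"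
      by (metis zero_neq_one)
  qed
qed (transfer; force simp: algebra_simps)+

end

lift_definition const :: "complex \<Rightarrow> smooth_fun" is "\<lambda>c x. if x = 0 then 0 else c"
  by (simp add: smooth_on_const smooth_on_if_zero)

lift_definition coord :: "3 \<Rightarrow> smooth_fun" is "\<lambda>k x. complex_of_real (x $ k)"
  by (rule conjI, rule smooth_on_bounded_linear[OF open_punctured
        bounded_linear_compose[OF bounded_linear_of_real bounded_linear_vec_nth]]) simp

text \<open>The default 0 for profiles that are not smooth makes this a total map into the
  ring.\<close>

lift_definition radial :: "(real \<Rightarrow> real) \<Rightarrow> smooth_fun"
  is "\<lambda>g x. if x = 0 \<or> \<not> smooth_on {0<..} g then 0 else complex_of_real (g (norm x))"
  subgoal for g
    by (cases "smooth_on {0<..} g")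
      (simp_all add: smooth_on_const smooth_on_if_zero smooth_on_radial
        smooth_on_bounded_linear_compose[OF _ bounded_linear_of_real])
  done

lift_definition pd :: "3 \<Rightarrow> smooth_fun \<Rightarrow> smooth_fun"
  is "\<lambda>k f x. if x = 0 then 0 else frechet_derivative f (at x) (axis k 1)"
  by (simp add: smooth_on_if_zero smooth_on_frechet_derivative)

section \<open>Pointwise values and the rules of differentiation\<close>

lemma sval_zero_arg [simp]: "sval f 0 = 0"
  by transfer simp

lemma smooth_fun_eqI:
  assumes "\<And>x. x \<noteq> 0 \<Longrightarrow> sval f x = sval g x"
  shows "f = g"
proof -
  have "sval f x = sval g x" for x
    using assms by (cases "x = 0") auto
  then show ?thesis by (auto simp: sval_inject[symmetric])
qed

lemma sval_simps [simp]:
  assumes "x \<noteq> 0"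
  shows "sval 0 x = 0" "sval 1 x = 1" "sval (f + g) x = sval f x + sval g x"
    "sval (- f) x = - sval f x" "sval (f - g) x = sval f x - sval g x"
    "sval (f * g) x = sval f x * sval g x" "sval (const c) x = c"
    "sval (coord k) x = complex_of_real (x $ k)"
    "sval (pd k f) x = frechet_derivative (sval f) (at x) (axis k 1)"
    "smooth_on {0<..} r \<Longrightarrow> sval (radial r) x = complex_of_real (r (norm x))"
  using assms
  by (simp_all add: zero_smooth_fun.rep_eq one_smooth_fun.rep_eq plus_smooth_fun.rep_eq
      uminus_smooth_fun.rep_eq minus_smooth_fun.rep_eq times_smooth_fun.rep_eq const.rep_eq
      coord.rep_eq radial.rep_eq pd.rep_eq)

lemma sval_numeral [simp]: "x \<noteq> 0 \<Longrightarrow> sval (numeral n) x = numeral n"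
proof -
  assume "x \<noteq> 0"
  then have "sval (of_nat m) x = of_nat m" for m
    by (induction m) simp_all
  from this[of "numeral n"] show ?thesis by simp
qed

lemma smooth_on_sval: "smooth_on (- {0}) (sval f)"
  by transfer simp

lemma sval_has_derivative:
  "x \<noteq> 0 \<Longrightarrow> (sval f has_derivative frechet_derivative (sval f) (at x)) (at x)"
  using smooth_on_has_derivative[OF smooth_on_sval] by simp

text \<open>Differentiation is local, so off the origin \<open>sval f\<close> may be replaced by any
  expression \<open>h\<close> that agrees with it there. The rules for \<open>pd\<close> follow from
  the standard derivative rules in this way.\<close>

lemma sval_pdI:
  assumes "x \<noteq> 0" "(h has_derivative h') (at x)" "\<And>y. y \<noteq> 0 \<Longrightarrow> sval f y = h y"
  shows "sval (pd k f) x = h' (axis k 1)"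
proof -
  have "(sval f has_derivative h') (at x)"
    using assms by (intro has_derivative_transform_within_open[OF assms(2), of "- {0}"]) auto
  with assms(1) show ?thesis
    using frechet_derivative_at by (metis sval_simps(9))
qed

lemma pd_add [simp]: "pd k (f + g) = pd k f + pd k g"
  by (rule smooth_fun_eqI,
      subst sval_pdI[OF _ has_derivative_add[OF sval_has_derivative sval_has_derivative]]) auto

lemma pd_minus [simp]: "pd k (- f) = - pd k f"
  by (rule smooth_fun_eqI,
      subst sval_pdI[OF _ has_derivative_minus[OF sval_has_derivative]]) auto

lemma pd_diff [simp]: "pd k (f - g) = pd k f - pd k g"
  by (rule smooth_fun_eqI,
      subst sval_pdI[OF _ has_derivative_diff[OF sval_has_derivative sval_has_derivative]]) auto

lemma pd_mult [simp]: "pd k (f * g) = f * pd k g + pd k f * g"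
  by (rule smooth_fun_eqI,
      subst sval_pdI[OF _ has_derivative_mult[OF sval_has_derivative sval_has_derivative]]) auto

lemma pd_const [simp]: "pd k (const c) = 0"
  by (rule smooth_fun_eqI, subst sval_pdI[OF _ has_derivative_const]) auto

lemma pd_zero [simp]: "pd k 0 = 0"
  by (rule smooth_fun_eqI, subst sval_pdI[OF _ has_derivative_const]) auto

lemma pd_one [simp]: "pd k 1 = 0"
  by (rule smooth_fun_eqI, subst sval_pdI[OF _ has_derivative_const]) auto

lemma pd_coord [simp]: "pd k (coord j) = (if j = k then 1 else 0)"
  by (rule smooth_fun_eqI, subst sval_pdI[OF _ bounded_linear_imp_has_derivative[OF
      bounded_linear_compose[OF bounded_linear_of_real bounded_linear_vec_nth]]])
    (auto simp: axis_def)

text \<open>The gradient is the radial function of g'(r)/r times the position vector and so stays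
  inside the ring.\<close>

lemma pd_radial [simp]:
  assumes "smooth_on {0<..} g"
  shows "pd k (radial g) = radial (\<lambda>r. deriv g r * inverse r) * coord k"
proof (rule smooth_fun_eqI)
  fix x :: "real ^ 3" assume x: "x \<noteq> 0"
  have "smooth_on {0<..} (\<lambda>r. deriv g r * inverse r)"
    using assms by (simp add: smooth_on_mult smooth_on_deriv smooth_on_inverse)
  with x show "sval (pd k (radial g)) x = sval (radial (\<lambda>r. deriv g r * inverse r) * coord k) x"
    using assms
    by (subst sval_pdI[OF x has_derivative_of_real[OF has_derivative_radial[OF assms x]]])
      (auto simp: inner_axis)
qed

lemma pd_commute: "pd i (pd j f) = pd j (pd i f)"
proof (rule smooth_fun_eqI)
  fix x :: "real ^ 3" assume x: "x \<noteq> 0"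
  have "sval (pd i (pd j f)) x
    = frechet_derivative (\<lambda>x. frechet_derivative (sval f) (at x) (axis j 1)) (at x) (axis i 1)"
    for i j
    using x smooth_on_has_derivative[OF smooth_on_frechet_derivative[OF smooth_on_sval[of f]]]
    by (intro sval_pdI) auto
  then show "sval (pd i (pd j f)) x = sval (pd j (pd i f)) x"
    using frechet_derivative_commute[OF _ smooth_on_sval[of f]] x by simp
qed

lemma const_simps:
  "const 0 = 0" "const 1 = 1" "const (a + b) = const a + const b" "const (- a) = - const a"
  "const (a * b) = const a * const b" "const (numeral n) = numeral n"
  by (rule smooth_fun_eqI; simp)+

subsection \<open>Operators in singlet-triplet components\<close>

type_synonym smooth_spinor = "smooth_fun \<times> smooth_fun \<times> smooth_fun \<times> smooth_fun"

text \<open>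
  The singlet component and the components of the triplet in a Cartesian basis, with phases such that
  $\vec\sigma_1$ and $\vec\sigma_2$ act by the vector formula in \<open>spinor_sigma\<close> below.
\<close>

definition represents :: "smooth_spinor \<Rightarrow> spin_field \<Rightarrow> bool" where
  "represents = (\<lambda>(s, t1, t2, t3) \<psi>. \<forall>x. x \<noteq> 0 \<longrightarrow>
     sval s x = \<psi> x $ (1, 2) - \<psi> x $ (2, 1) \<and>
     sval t1 x = \<psi> x $ (2, 2) - \<psi> x $ (1, 1) \<and>
     sval t2 x = - \<i> * (\<psi> x $ (1, 1) + \<psi> x $ (2, 2)) \<and>
     sval t3 x = \<psi> x $ (1, 2) + \<psi> x $ (2, 1))"

declare split_paired_All [simp del]

text \<open>\<open>A'\<close> is the action of \<open>A\<close> in singlet-triplet components. Only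
  smooth fields are concerned, because no other field is represented.\<close>

definition lifts :: "spin_op \<Rightarrow> (smooth_spinor \<Rightarrow> smooth_spinor) \<Rightarrow> bool" where
  "lifts A A' \<longleftrightarrow> (\<forall>\<psi> \<Psi>. represents \<Psi> \<psi> \<longrightarrow> represents (A' \<Psi>) (A \<psi>))"

lemma forall_2x2: "(\<forall>i :: 2 \<times> 2. P i) \<longleftrightarrow> P (1, 1) \<and> P (1, 2) \<and> P (2, 1) \<and> P (2, 2)"
  by (simp add: split_paired_All forall_2)

lemma sum_2x2:
  "(\<Sum>i\<in>(UNIV :: (2 \<times> 2) set). f i) = f (1, 1) + f (1, 2) + f (2, 1) + f (2, 2)"
proof -
  have *: "UNIV = {(1, 1), (1, 2), (2, 1), (2, 2 :: 2) :: 2 \<times> 2}"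
    using UNIV_2 by (auto simp: UNIV_Times_UNIV[symmetric] simp del: UNIV_Times_UNIV)
  show ?thesis by (subst *) (simp add: add.assoc)
qed

text \<open>The function is the sum of its components, each embedded by the bounded linear map
  \<open>axis i\<close>.\<close>

lemma smooth_on_vec:
  fixes f :: "'a::real_normed_vector \<Rightarrow> complex ^ 'n"
  assumes "open S" "\<And>i. smooth_on S (\<lambda>x. f x $ i)"
  shows "smooth_on S f"
proof -
  have "bounded_linear (axis i :: complex \<Rightarrow> complex ^ 'n)" for i
    by (auto simp: linear_conv_bounded_linear[symmetric] linear_iff vec_eq_iff axis_def)
  then have "smooth_on S (\<lambda>x. \<Sum>i\<in>UNIV. axis i (f x $ i))"
    using assms by (intro smooth_on_sum smooth_on_bounded_linear_compose[of S "axis _"]) auto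
  moreover have "f x = (\<Sum>i\<in>UNIV. axis i (f x $ i))" for x
    by (simp add: vec_eq_iff axis_def)
  ultimately show ?thesis by simp
qed

text \<open>The inverse of the change of basis in \<open>represents\<close>.\<close>

lemma represents_components:
  assumes "represents (s, t1, t2, t3) \<psi>" "x \<noteq> 0"
  shows "\<psi> x $ (1, 1) = (\<i> * sval t2 x - sval t1 x) / 2"
    and "\<psi> x $ (1, 2) = (sval s x + sval t3 x) / 2"
    and "\<psi> x $ (2, 1) = (sval t3 x - sval s x) / 2"
    and "\<psi> x $ (2, 2) = (sval t1 x + \<i> * sval t2 x) / 2"
proof -
  have eqs: "sval s x = \<psi> x $ (1, 2) - \<psi> x $ (2, 1)"
     "sval t1 x = \<psi> x $ (2, 2) - \<psi> x $ (1, 1)"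
     "sval t2 x = - \<i> * (\<psi> x $ (1, 1) + \<psi> x $ (2, 2))"
     "sval t3 x = \<psi> x $ (1, 2) + \<psi> x $ (2, 1)"
    using assms by (auto simp: represents_def)
  show "\<psi> x $ (1, 1) = (\<i> * sval t2 x - sval t1 x) / 2"
    "\<psi> x $ (1, 2) = (sval s x + sval t3 x) / 2"
    "\<psi> x $ (2, 1) = (sval t3 x - sval s x) / 2"
    "\<psi> x $ (2, 2) = (sval t1 x + \<i> * sval t2 x) / 2"
    unfolding eqs by (simp_all add: field_simps)
qed

section \<open>Correspondence between smooth fields and quadruples\<close>

lemma represents_imp_smooth:
  assumes "represents \<Psi> \<psi>"
  shows "\<psi> \<in> smooth_fields"
proof -
  obtain s t1 t2 t3 where \<Psi>: "\<Psi> = (s, t1, t2, t3)" by (cases \<Psi>)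
  have *: "smooth_on (- {0}) (\<lambda>x. c * sval f x + d * sval g x)" for c d f g
    by (intro smooth_on_add smooth_on_mult smooth_on_const smooth_on_sval) auto
  have **: "smooth_on (- {0}) (\<lambda>x. \<psi> x $ i)"
    if "\<And>x. x \<noteq> 0 \<Longrightarrow> \<psi> x $ i = c * sval f x + d * sval g x" for i c d f g
    using * that by (subst smooth_on_cong[where g = "\<lambda>x. c * sval f x + d * sval g x"]) auto
  note rep = represents_components[OF assms[unfolded \<Psi>]]
  have "\<forall>i. smooth_on (- {0}) (\<lambda>x. \<psi> x $ i)"
    unfolding forall_2x2
    using **[of "(1, 1)" "\<i> / 2" t2 "- (1 / 2)" t1] **[of "(1, 2)" "1 / 2" s "1 / 2" t3]
      **[of "(2, 1)" "1 / 2" t3 "- (1 / 2)" s] **[of "(2, 2)" "1 / 2" t1 "\<i> / 2" t2]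
    by (simp add: rep diff_divide_distrib add_divide_distrib)
  then show ?thesis
    by (simp add: smooth_fields_def smooth_on_vec)
qed

lemma represents_exists:
  assumes "\<psi> \<in> smooth_fields"
  obtains \<Psi> where "represents \<Psi> \<psi>"
proof -
  have "smooth_on (- {0}) (\<lambda>x. \<psi> x $ i)" for i
    using assms smooth_on_bounded_linear_compose[OF open_punctured bounded_linear_vec_nth]
    by (auto simp: smooth_fields_def)
  then have *: "\<exists>f. \<forall>x. x \<noteq> 0 \<longrightarrow> sval f x = c * \<psi> x $ i + d * \<psi> x $ j" for c d i j
    by (intro exI[of _ "Smooth_fun (\<lambda>x. if x = 0 then 0 else c * \<psi> x $ i + d * \<psi> x $ j)"])
      (simp add: Smooth_fun_inverse smooth_on_if_zero smooth_on_add smooth_on_mult smooth_on_const)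
  obtain s where "\<forall>x. x \<noteq> 0 \<longrightarrow> sval s x = 1 * \<psi> x $ (1, 2) + (-1) * \<psi> x $ (2, 1)"
    using * by blast
  moreover obtain t1 where "\<forall>x. x \<noteq> 0 \<longrightarrow> sval t1 x = 1 * \<psi> x $ (2, 2) + (-1) * \<psi> x $ (1, 1)"
    using * by blast
  moreover obtain t2 where "\<forall>x. x \<noteq> 0 \<longrightarrow> sval t2 x = - \<i> * \<psi> x $ (1, 1) + - \<i> * \<psi> x $ (2, 2)"
    using * by blast
  moreover obtain t3 where "\<forall>x. x \<noteq> 0 \<longrightarrow> sval t3 x = 1 * \<psi> x $ (1, 2) + 1 * \<psi> x $ (2, 1)"
    using * by blast
  ultimately have "represents (s, t1, t2, t3) \<psi>"
    by (simp add: represents_def algebra_simps)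
  then show ?thesis by (rule that)
qed

lemma represented_exists:
  obtains \<psi> where "represents \<Psi> \<psi>"
proof -
  obtain s t1 t2 t3 where \<Psi>: "\<Psi> = (s, t1, t2, t3)" by (cases \<Psi>)
  define \<psi> :: spin_field where
    "\<psi> = (\<lambda>x. \<chi> i. if i = (1, 1) then (\<i> * sval t2 x - sval t1 x) / 2
      else if i = (1, 2) then (sval s x + sval t3 x) / 2
      else if i = (2, 1) then (sval t3 x - sval s x) / 2
      else (sval t1 x + \<i> * sval t2 x) / 2)"
  have "represents \<Psi> \<psi>"
    by (simp add: \<Psi> \<psi>_def represents_def field_simps)
  then show ?thesis by (rule that)
qed

lemma represents_unique:
  assumes "represents \<Psi> \<psi>" "represents \<Phi> \<phi>" "field_eq \<psi> \<phi>"
  shows "\<Psi> = \<Phi>"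
  using assms by (cases \<Psi>; cases \<Phi>) (auto simp: represents_def field_eq_def intro!: smooth_fun_eqI)

lemma represents_field_eq:
  assumes "represents \<Psi> \<psi>" "represents \<Psi> \<phi>"
  shows "field_eq \<psi> \<phi>"
  using assms
  by (cases \<Psi>) (auto simp: field_eq_def vec_eq_iff forall_2x2 represents_components
      simp del: split_paired_All)

text \<open>Quadruples correspond bijectively to smooth fields modulo \<open>field_eq\<close>. The
  direction from right to left proves operator identities by ring computations; the other one shows
  that commutators do not vanish.\<close>

lemma op_eq_iff_lifts:
  assumes "lifts A A'" "lifts B B'"
  shows "op_eq A B \<longleftrightarrow> A' = B'"
proof
  assume eq: "op_eq A B"
  show "A' = B'"
  proof
    fix \<Psi>
    obtain \<psi> where "represents \<Psi> \<psi>" by (rule represented_exists)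
    with assms eq show "A' \<Psi> = B' \<Psi>"
      using represents_imp_smooth represents_unique unfolding lifts_def op_eq_def by blast
  qed
next
  assume "A' = B'"
  with assms show "op_eq A B"
    unfolding op_eq_def lifts_def by (metis represents_exists represents_field_eq)
qed

definition spinor_scale :: "smooth_fun \<Rightarrow> smooth_spinor \<Rightarrow> smooth_spinor" where
  "spinor_scale f = (\<lambda>(s, t1, t2, t3). (f * s, f * t1, f * t2, f * t3))"

definition spinor_pd :: "3 \<Rightarrow> smooth_spinor \<Rightarrow> smooth_spinor" where
  "spinor_pd k = (\<lambda>(s, t1, t2, t3). (pd k s, pd k t1, pd k t2, pd k t3))"

text \<open>The Pauli matrices of the first (\<open>e = 1\<close>) and second (\<open>e = - 1\<close>) particle:
  $(s, \vec t) \mapsto (e\,t_k,\; e\,s\,\vec e_k + i\,\vec e_k \times \vec t)$.\<close>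

definition spinor_sigma :: "smooth_fun \<Rightarrow> 3 \<Rightarrow> smooth_spinor \<Rightarrow> smooth_spinor" where
  "spinor_sigma e k = (\<lambda>(s, t1, t2, t3).
     if k = 1 then (e * t1, e * s, - const \<i> * t3, const \<i> * t2)
     else if k = 2 then (e * t2, const \<i> * t3, e * s, - const \<i> * t1)
     else (e * t3, - const \<i> * t2, const \<i> * t1, e * s))"

definition spinor_linear :: "(smooth_spinor \<Rightarrow> smooth_spinor) \<Rightarrow> bool" where
  "spinor_linear A \<longleftrightarrow> (\<forall>c d \<Psi> \<Phi>. A (spinor_scale (const c) \<Psi> + spinor_scale (const d) \<Phi>)
     = spinor_scale (const c) (A \<Psi>) + spinor_scale (const d) (A \<Phi>))"

text \<open>A lift by itself gives preservation of smoothness and independence of the value at the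
  origin, as both hold for represented fields. Linearity is transported from
  \<open>A'\<close>.\<close>

lemma is_operator_lifts:
  assumes "lifts A A'" "spinor_linear A'"
  shows "is_operator A"
proof -
  have *: "represents (spinor_scale (const c) \<Psi> + spinor_scale (const d) \<Phi>)
      (\<lambda>x. c *s \<psi> x + d *s \<phi> x)"
    if "represents \<Psi> \<psi>" "represents \<Phi> \<phi>" for c d \<Psi> \<Phi> \<psi> \<phi>
    using that
    by (cases \<Psi>; cases \<Phi>) (simp add: represents_def spinor_scale_def, simp add: algebra_simps)
  show ?thesis
    unfolding is_operator_def
  proof (intro conjI ballI impI allI)
    fix \<psi> assume "\<psi> \<in> smooth_fields"
    then show "A \<psi> \<in> smooth_fields"
      using assms(1) unfolding lifts_def by (metis represents_exists represents_imp_smooth)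
  next
    fix \<psi> \<phi> assume eq: "\<psi> \<in> smooth_fields" "\<phi> \<in> smooth_fields" "field_eq \<psi> \<phi>"
    obtain \<Psi> \<Phi> where rep: "represents \<Psi> \<psi>" "represents \<Phi> \<phi>"
      using eq(1,2) by (meson represents_exists)
    then have "\<Psi> = \<Phi>" using eq(3) by (rule represents_unique)
    then have "represents (A' \<Psi>) (A \<psi>)" "represents (A' \<Psi>) (A \<phi>)"
      using rep assms(1) by (simp_all add: lifts_def)
    then show "field_eq (A \<psi>) (A \<phi>)" by (rule represents_field_eq)
  next
    fix \<psi> \<phi> c d assume "\<psi> \<in> smooth_fields" "\<phi> \<in> smooth_fields"
    then obtain \<Psi> \<Phi> where "represents \<Psi> \<psi>" "represents \<Phi> \<phi>"
      by (meson represents_exists)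
    then have "represents (A' (spinor_scale (const c) \<Psi> + spinor_scale (const d) \<Phi>))
        (A (\<lambda>x. c *s \<psi> x + d *s \<phi> x))"
      "represents (spinor_scale (const c) (A' \<Psi>) + spinor_scale (const d) (A' \<Phi>))
        (\<lambda>x. c *s A \<psi> x + d *s A \<phi> x)"
      using * assms(1) unfolding lifts_def by auto
    then show "field_eq (A (\<lambda>x. c *s \<psi> x + d *s \<phi> x)) (\<lambda>x. c *s A \<psi> x + d *s A \<phi> x)"
      unfolding assms(2)[unfolded spinor_linear_def, rule_format] by (rule represents_field_eq)
  qed
qed

section \<open>Lifts of elementary operators and of their combinations\<close>

lemma lifts_id: "lifts id (\<lambda>\<Psi>. \<Psi>)"
  by (simp add: lifts_def)

lemma lifts_zero: "lifts 0 (\<lambda>_. 0)"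
  by (auto simp: lifts_def represents_def zero_prod_def)

lemma lifts_comp: "lifts A A' \<Longrightarrow> lifts B B' \<Longrightarrow> lifts (A \<odot> B) (\<lambda>\<Psi>. A' (B' \<Psi>))"
  by (simp add: lifts_def)

lemma lifts_add:
  assumes "lifts A A'" "lifts B B'"
  shows "lifts (A + B) (\<lambda>\<Psi>. A' \<Psi> + B' \<Psi>)"
  unfolding lifts_def
proof (intro allI impI)
  fix \<psi> \<Psi> assume "represents \<Psi> \<psi>"
  with assms have "represents (A' \<Psi>) (A \<psi>)" "represents (B' \<Psi>) (B \<psi>)"
    by (simp_all add: lifts_def)
  then show "represents (A' \<Psi> + B' \<Psi>) ((A + B) \<psi>)"
    by (cases "A' \<Psi>"; cases "B' \<Psi>") (simp add: represents_def distrib_left right_diff_distrib)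
qed

lemma lifts_diff:
  assumes "lifts A A'" "lifts B B'"
  shows "lifts (A - B) (\<lambda>\<Psi>. A' \<Psi> - B' \<Psi>)"
  unfolding lifts_def
proof (intro allI impI)
  fix \<psi> \<Psi> assume "represents \<Psi> \<psi>"
  with assms have "represents (A' \<Psi>) (A \<psi>)" "represents (B' \<Psi>) (B \<psi>)"
    by (simp_all add: lifts_def)
  then show "represents (A' \<Psi> - B' \<Psi>) ((A - B) \<psi>)"
    by (cases "A' \<Psi>"; cases "B' \<Psi>") (simp add: represents_def distrib_left right_diff_distrib)
qed

text \<open>Serves constants, coordinates and radial functions alike: a scalar function multiplies
  all four components in either basis.\<close>

lemma lifts_multiplication:
  assumes "lifts A A'" "\<And>x. x \<noteq> 0 \<Longrightarrow> sval f x = c x"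
  shows "lifts (\<lambda>\<psi> x. c x *s A \<psi> x) (\<lambda>\<Psi>. spinor_scale f (A' \<Psi>))"
  unfolding lifts_def
proof (intro allI impI)
  fix \<psi> \<Psi> assume "represents \<Psi> \<psi>"
  with assms have "represents (A' \<Psi>) (A \<psi>)"
    by (simp add: lifts_def)
  then show "represents (spinor_scale f (A' \<Psi>)) (\<lambda>x. c x *s A \<psi> x)"
    using assms(2)
    by (cases "A' \<Psi>")
      (simp add: represents_def spinor_scale_def distrib_left right_diff_distrib mult.left_commute)
qed

lemma lifts_scale: "lifts A A' \<Longrightarrow> lifts (op_scale c A) (\<lambda>\<Psi>. spinor_scale (const c) (A' \<Psi>))"
  unfolding op_scale_def by (rule lifts_multiplication) auto

lemma lifts_position: "lifts (position_op k) (spinor_scale (coord k))"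
  using lifts_multiplication[OF lifts_id, of "coord k" "\<lambda>x. complex_of_real (x $ k)"]
  by (simp add: position_op_def[abs_def])

lemma lifts_radial_op:
  assumes "\<And>x. x \<noteq> 0 \<Longrightarrow> sval f x = complex_of_real (g (norm x))"
  shows "lifts (radial_op g) (spinor_scale f)"
  using lifts_multiplication[OF lifts_id assms] by (simp add: radial_op_def)

text \<open>The change of basis has constant coefficients, so it commutes with
  differentiation.\<close>

lemma lifts_partial: "lifts (partial_op k) (spinor_pd k)"
  unfolding lifts_def
proof (intro allI impI)
  fix \<psi> \<Psi> assume rep: "represents \<Psi> \<psi>"
  obtain s t1 t2 t3 where \<Psi>: "\<Psi> = (s, t1, t2, t3)" by (cases \<Psi>)
  have "((\<lambda>x. \<psi> x $ i) has_derivative (\<lambda>v. frechet_derivative \<psi> (at x) v $ i)) (at x)"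
    if "x \<noteq> 0" for x i
    using represents_imp_smooth[OF rep] that
    by (intro bounded_linear.has_derivative[OF bounded_linear_vec_nth])
      (auto simp: smooth_fields_def intro: smooth_on_has_derivative)
  \<comment> \<open>All four combinations in \<open>represents\<close> have this shape, so one
    derivative rule covers them.\<close>
  then have "((\<lambda>x. c * (\<psi> x $ i + d * \<psi> x $ j)) has_derivative
      (\<lambda>v. c * (frechet_derivative \<psi> (at x) v $ i + d * frechet_derivative \<psi> (at x) v $ j))) (at x)"
    if "x \<noteq> 0" for x i j c d
    using that by (intro has_derivative_mult_right has_derivative_add) auto
  note D = sval_pdI[OF _ this]
  have "sval (pd k s) x = 1 * (partial_op k \<psi> x $ (1, 2) + (- 1) * partial_op k \<psi> x $ (2, 1))"
    "sval (pd k t1) x = 1 * (partial_op k \<psi> x $ (2, 2) + (- 1) * partial_op k \<psi> x $ (1, 1))"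
    "sval (pd k t2) x = - \<i> * (partial_op k \<psi> x $ (1, 1) + 1 * partial_op k \<psi> x $ (2, 2))"
    "sval (pd k t3) x = 1 * (partial_op k \<psi> x $ (1, 2) + 1 * partial_op k \<psi> x $ (2, 1))"
    if "x \<noteq> 0" for x
    unfolding partial_op_def using rep that
    by (intro D; simp add: \<Psi> represents_def)+
  then show "represents (spinor_pd k \<Psi>) (partial_op k \<psi>)"
    by (simp add: \<Psi> represents_def spinor_pd_def)
qed

lemma lifts_sigma1: "lifts (sigma1 k) (spinor_sigma 1 k)"
  using exhaust_3[of k]
  by (auto simp: lifts_def represents_def spinor_sigma_def sigma1_def matrix_op_def
      kronecker_def pauli_def matrix_vector_mult_def sum_2x2 mat_def distrib_left right_diff_distrib)

lemma lifts_sigma2: "lifts (sigma2 k) (spinor_sigma (- 1) k)"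
  using exhaust_3[of k]
  by (auto simp: lifts_def represents_def spinor_sigma_def sigma2_def matrix_op_def
      kronecker_def pauli_def matrix_vector_mult_def sum_2x2 mat_def distrib_left right_diff_distrib)

lemma lifts_op_dot:
  assumes "\<And>k. lifts (A k) (A' k)" "\<And>k. lifts (B k) (B' k)"
  shows "lifts (op_dot A B) (\<lambda>\<Psi>. A' 1 (B' 1 \<Psi>) + A' 2 (B' 2 \<Psi>) + A' 3 (B' 3 \<Psi>))"
  unfolding op_dot_def sum_3 by (intro lifts_add lifts_comp assms)

lemma lifts_op_cross:
  assumes "\<And>k. lifts (A k) (A' k)" "\<And>k. lifts (B k) (B' k)"
  shows "lifts (op_cross A B k) (\<lambda>\<Psi>. A' (k + 1) (B' (k + 2) \<Psi>) - A' (k + 2) (B' (k + 1) \<Psi>))"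
  unfolding op_cross_def by (intro lifts_diff lifts_comp assms)

lemma lifts_momentum:
  "lifts (momentum_op hbar k)
    (\<lambda>\<Psi>. spinor_scale (const (- \<i> * complex_of_real hbar)) (spinor_pd k \<Psi>))"
  unfolding momentum_op_def by (intro lifts_scale lifts_partial)

lemma lifts_comm:
  "lifts A A' \<Longrightarrow> lifts B B' \<Longrightarrow> lifts (op_comm A B) (\<lambda>\<Psi>. A' (B' \<Psi>) - B' (A' \<Psi>))"
  unfolding op_comm_def by (intro lifts_diff lifts_comp)

subsection \<open>The Hamiltonian and its integrals\<close>

text \<open>The component pi_k; with \<open>- g\<close> in place of \<open>g\<close> it is the
  component of pi^*.\<close>

definition kin_mom :: "real \<Rightarrow> smooth_fun \<Rightarrow> 3 \<Rightarrow> smooth_fun \<Rightarrow> smooth_fun" where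
  "kin_mom hbar g k f = - const (\<i> * complex_of_real hbar) * pd k f - const \<i> * g * coord k * f"

lemma kin_mom_add: "kin_mom hbar g k (f1 + f2) = kin_mom hbar g k f1 + kin_mom hbar g k f2"
  by (simp add: kin_mom_def algebra_simps)

lemma kin_mom_diff: "kin_mom hbar g k (f1 - f2) = kin_mom hbar g k f1 - kin_mom hbar g k f2"
  by (simp add: kin_mom_def algebra_simps)

lemma kin_mom_minus: "kin_mom hbar g k (- f) = - kin_mom hbar g k f"
  by (simp add: kin_mom_def algebra_simps)

lemma kin_mom_zero: "kin_mom hbar g k 0 = 0"
  by (simp add: kin_mom_def)

lemma kin_mom_const_mult: "kin_mom hbar g k (const c * f) = const c * kin_mom hbar g k f"
  by (simp add: kin_mom_def algebra_simps)

text \<open>The commutator is a multiple of a component of the curl of g x. This vanishes because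
  the gradient of \<open>g\<close> is parallel to x.\<close>

lemma kin_mom_commute:
  assumes "\<And>k. pd k g = h * coord k"
  shows "kin_mom hbar g i (kin_mom hbar g j f) = kin_mom hbar g j (kin_mom hbar g i f)"
  by (simp add: kin_mom_def assms algebra_simps pd_commute[of i j])

text \<open>The common form of both integrals: \<open>c\<close> weights the passage from triplet to
  singlet, \<open>d\<close> the passage from singlet to triplet.\<close>

definition exchange_op ::
  "complex \<Rightarrow> complex \<Rightarrow> real \<Rightarrow> smooth_fun \<Rightarrow> smooth_spinor \<Rightarrow> smooth_spinor"
where
  "exchange_op c d hbar g = (\<lambda>(s, t1, t2, t3).
     (const c * (kin_mom hbar (- g) 1 t1 + kin_mom hbar (- g) 2 t2 + kin_mom hbar (- g) 3 t3),
      const d * kin_mom hbar g 1 s, const d * kin_mom hbar g 2 s, const d * kin_mom hbar g 3 s))"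

definition spin_spin :: "smooth_spinor \<Rightarrow> smooth_spinor" where
  "spin_spin = (\<lambda>(s, t1, t2, t3). (const (- 3) * s, t1, t2, t3))"

text \<open>The form of H, with \<open>e\<close> for \<open>d6\<close>, \<open>a\<close> for (1 - 2
  \<alpha>)/2, which is half the constant a of the theorem, and \<open>b\<close> for (1 + 2
  \<alpha>)/2. The terms with j = k of the curl part are zero and are left out.\<close>

definition block_ham ::
  "complex \<Rightarrow> complex \<Rightarrow> complex \<Rightarrow> real \<Rightarrow> smooth_fun \<Rightarrow> smooth_spinor \<Rightarrow> smooth_spinor"
where
  "block_ham e a b hbar g = (\<lambda>(s, t1, t2, t3).
     let P = kin_mom hbar g; Q = kin_mom hbar (- g); d = Q 1 t1 + Q 2 t2 + Q 3 t3 in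
     (const e * s + const a * (Q 1 (P 1 s) + Q 2 (P 2 s) + Q 3 (P 3 s)),
      const e * t1 + const a * P 1 d + const b * (Q 2 (P 2 t1 - P 1 t2) + Q 3 (P 3 t1 - P 1 t3)),
      const e * t2 + const a * P 2 d + const b * (Q 1 (P 1 t2 - P 2 t1) + Q 3 (P 3 t2 - P 2 t3)),
      const e * t3 + const a * P 3 d + const b * (Q 1 (P 1 t3 - P 3 t1) + Q 2 (P 2 t3 - P 3 t2))))"

text \<open>The cyclic cross product formula produces the indices 2 + 2, 3 + 1 and 3 + 2.\<close>

lemma index_3 [simp]:
  "(4 :: 3) = 1" "(5 :: 3) = 2" "(2 :: 3) \<noteq> 1" "(3 :: 3) \<noteq> 1" "(3 :: 3) \<noteq> 2" "(1 :: 3) \<noteq> 2"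
  by simp_all

section \<open>Lifts of K, of the two first-order integrals and of H\<close>

lemma lifts_sigma_diff:
  "lifts ((sigma1 - sigma2) k) (\<lambda>\<Psi>. spinor_sigma 1 k \<Psi> - spinor_sigma (- 1) k \<Psi>)"
  unfolding fun_diff_def[of sigma1 sigma2] by (intro lifts_diff lifts_sigma1 lifts_sigma2)

lemma lifts_sigma_diff':
  "lifts ((sigma2 - sigma1) k) (\<lambda>\<Psi>. spinor_sigma (- 1) k \<Psi> - spinor_sigma 1 k \<Psi>)"
  unfolding fun_diff_def[of sigma2 sigma1] by (intro lifts_diff lifts_sigma1 lifts_sigma2)

lemma lifts_sigma_sum:
  "lifts ((sigma1 + sigma2) k) (\<lambda>\<Psi>. spinor_sigma 1 k \<Psi> + spinor_sigma (- 1) k \<Psi>)"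
  unfolding plus_fun_def[of sigma1 sigma2] by (intro lifts_add lifts_sigma1 lifts_sigma2)

lemma lifts_cong:
  "lifts A A' \<Longrightarrow>
   (\<And>s t1 t2 t3. A' (s, t1, t2, t3) = A'' (s, t1, t2, t3)) \<Longrightarrow> lifts A A''"
  by (metis (full_types) ext surj_pair)

lemmas spinor_defs = spinor_sigma_def spinor_scale_def spinor_pd_def prod_eq_iff

lemma lifts_K: "lifts (op_dot sigma1 sigma2) spin_spin"
  by (rule lifts_cong[OF lifts_op_dot[OF lifts_sigma1 lifts_sigma2]])
    (simp add: spinor_defs spin_spin_def; intro conjI smooth_fun_eqI; simp)

text \<open>The k-th component of \<open>sigma1 - sigma2\<close> sends (s, t) to (2 t_k, 2 s e_k),
  that of the cross product to (2 i t_k, - 2 i s e_k). Together they build 2 pi^* . t and 2 pi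
  s.\<close>

lemma lifts_Y26:
  assumes "d4 \<noteq> 0" "a \<noteq> 0"
    and g: "\<And>x. x \<noteq> 0 \<Longrightarrow> sval g x = complex_of_real (f2 (norm x) / d4)"
  shows "lifts (op_scale (complex_of_real (1 / a))
           (op_dot (sigma1 - sigma2) (momentum_op hbar)
            + radial_op (\<lambda>r. f2 r / d4) \<odot> op_dot position_op (op_cross sigma1 sigma2)))
     (exchange_op (complex_of_real (2 / a)) (complex_of_real (2 / a)) hbar g)"
  \<comment> \<open>Without \<open>sval_simps(9)\<close> the values of \<open>pd\<close> stay atoms,
    and the remaining claim is an algebraic identity at each point.\<close>
  by (rule lifts_cong[OF lifts_scale[OF lifts_add[OF lifts_op_dot[OF lifts_sigma_diff lifts_momentum]
      lifts_comp[OF lifts_radial_op[OF g] lifts_op_dot[OF lifts_position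
        lifts_op_cross[OF lifts_sigma1 lifts_sigma2]]]]]])
    (assumption, simp add: spinor_defs exchange_op_def kin_mom_def, intro conjI smooth_fun_eqI,
      simp_all add: assms(1,2) field_simps del: sval_simps(9))

text \<open>The roles of \<open>sigma1 - sigma2\<close> and the cross product are interchanged
  compared with \<open>lifts_Y26\<close>; this produces the opposite signs of the two
  weights.\<close>

lemma lifts_Y27:
  assumes "d4 \<noteq> 0"
    and g: "\<And>x. x \<noteq> 0 \<Longrightarrow> sval g x = complex_of_real (f2 (norm x) / d4)"
  shows "lifts (radial_op f2 \<odot> op_dot (sigma2 - sigma1) position_op
      + op_scale (complex_of_real d4) (op_dot (op_cross sigma1 sigma2) (momentum_op hbar)))
     (exchange_op (2 * \<i> * complex_of_real d4) (- 2 * \<i> * complex_of_real d4) hbar g)"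
proof -
  have f: "sval (const (complex_of_real d4) * g) x = complex_of_real (f2 (norm x))" if "x \<noteq> 0" for x
    using that assms by simp
  show ?thesis
    by (rule lifts_cong[OF lifts_add[OF lifts_comp[OF lifts_radial_op[OF f]
        lifts_op_dot[OF lifts_sigma_diff' lifts_position]]
     lifts_scale[OF lifts_op_dot[OF lifts_op_cross[OF lifts_sigma1 lifts_sigma2] lifts_momentum]]]])
    (assumption, simp add: spinor_defs exchange_op_def kin_mom_def, intro conjI smooth_fun_eqI,
      simp_all add: assms(1) field_simps del: sval_simps(9))
qed

lemma sval_norm_sq:
  "sval (coord 1 * coord 1 + coord 2 * coord 2 + coord 3 * coord 3) x = complex_of_real ((norm x)\<^sup>2)"
  by (cases "x = 0") (simp_all add: power2_norm_eq_inner inner_vec_def sum_3)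

text \<open>All potentials are polynomials in \<open>g\<close>, \<open>h\<close> and r^2, since f2 =
  d4 g and f2' = d4 r h. The claim thereby becomes a polynomial identity in these, the coordinates
  and partial derivatives.\<close>

lemma lifts_H:
  fixes f2 :: "real \<Rightarrow> real"
  assumes "d4 \<noteq> 0"
    and g: "\<And>x. x \<noteq> 0 \<Longrightarrow> sval g x = complex_of_real (f2 (norm x) / d4)"
    and h: "\<And>x. x \<noteq> 0 \<Longrightarrow> sval h x = complex_of_real (deriv f2 (norm x) / (d4 * norm x))"
    and pdg: "\<And>k. pd k g = h * coord k"
  shows "lifts (hamiltonian hbar
      (\<lambda>r. d6 + r\<^sup>2 * (f2 r)\<^sup>2 / (2 * d4\<^sup>2)
        - (1 + 2 * \<alpha>) * hbar / (4 * d4) * (3 * f2 r + r * deriv f2 r))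
      (\<lambda>r. - (2 * \<alpha> * f2 r / d4))
      (\<lambda>r. hbar * ((1 - 6 * \<alpha>) * f2 r + (1 - 2 * \<alpha>) * r * deriv f2 r) / (4 * d4))
      (\<lambda>r. (2 * \<alpha> * r * (f2 r)\<^sup>2 - d4 * hbar * deriv f2 r) / (2 * d4\<^sup>2 * r))
      (\<lambda>r. \<alpha>))
    (block_ham (complex_of_real d6) (complex_of_real ((1 - 2 * \<alpha>) / 2))
      (complex_of_real ((1 + 2 * \<alpha>) / 2)) hbar g)"
    (is "lifts (hamiltonian hbar ?V0 ?V1 ?V2 ?V3 ?V4) _")
proof -
  let ?c = "\<lambda>z. const (complex_of_real z)"
  define R where "R = coord 1 * coord 1 + coord 2 * coord 2 + coord 3 * coord 3"
  have R: "sval R x = complex_of_real ((norm x)\<^sup>2)" for x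
    unfolding R_def by (rule sval_norm_sq)
  have V0: "sval (?c d6 + ?c (1 / 2) * R * g * g - ?c ((1 + 2 * \<alpha>) * hbar / 4) * (3 * g + R * h)) x
      = complex_of_real (?V0 (norm x))" if "x \<noteq> 0" for x
    using that assms(1) by (simp add: g h R field_simps power2_eq_square)
  have V1: "sval (?c (- 2 * \<alpha>) * g) x = complex_of_real (?V1 (norm x))" if "x \<noteq> 0" for x
    using that assms(1) by (simp add: g h R field_simps power2_eq_square)
  have V2: "sval (?c (hbar * (1 - 6 * \<alpha>) / 4) * g + ?c (hbar * (1 - 2 * \<alpha>) / 4) * R * h) x
      = complex_of_real (?V2 (norm x))" if "x \<noteq> 0" for x
    using that assms(1) by (simp add: g h R field_simps power2_eq_square)
  have V3: "sval (?c \<alpha> * g * g - ?c (hbar / 2) * h) x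
      = complex_of_real (?V3 (norm x))" if "x \<noteq> 0" for x
    using that assms(1) by (simp add: g h R field_simps power2_eq_square)
  have V4: "sval (?c \<alpha>) x = complex_of_real (?V4 (norm x))" if "x \<noteq> 0" for x
    using that by simp
  note raw = lifts_add[OF lifts_add[OF lifts_add[OF lifts_add[OF lifts_add[OF
    lifts_scale[OF lifts_op_dot[OF lifts_partial lifts_partial]]
    lifts_radial_op[OF V0]]
    lifts_scale[OF lifts_comp[OF lifts_radial_op[OF V1] lifts_op_dot[OF lifts_sigma_sum
      lifts_op_cross[OF lifts_position lifts_momentum]]]]]
    lifts_comp[OF lifts_radial_op[OF V2] lifts_op_dot[OF lifts_sigma1 lifts_sigma2]]]
    lifts_comp[OF lifts_comp[OF lifts_radial_op[OF V3] lifts_op_dot[OF lifts_position lifts_sigma1]]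
      lifts_op_dot[OF lifts_position lifts_sigma2]]]
    lifts_comp[OF lifts_comp[OF lifts_radial_op[OF V4] lifts_op_dot[OF lifts_sigma1 lifts_momentum]]
      lifts_op_dot[OF lifts_sigma2 lifts_momentum]]]
  show ?thesis
    unfolding hamiltonian_def laplace_op_def angular_momentum_op_def
    \<comment> \<open>The instances of \<open>pd_commute\<close> put all mixed second derivatives
      into one order.\<close>
    by (rule lifts_cong[OF raw], assumption+, simp add: spinor_defs block_ham_def kin_mom_def pdg,
        intro conjI smooth_fun_eqI)
      (simp_all add: R_def pd_commute[of 2 1] pd_commute[of 3 1] pd_commute[of 3 2]
        power2_eq_square field_simps del: sval_simps(9))
qed

subsection \<open>Commutation relations\<close>

lemma kin_mom_mult_const: "kin_mom hbar g k (f * const c) = const c * kin_mom hbar g k f"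
  using kin_mom_const_mult[of hbar g k c f] by (simp add: mult.commute)

lemma kin_mom_mult_numeral: "kin_mom hbar g k (f * numeral n) = numeral n * kin_mom hbar g k f"
  using kin_mom_mult_const[of hbar g k f "numeral n"] by (simp add: const_simps)

lemmas kin_mom_linear = kin_mom_add kin_mom_diff kin_mom_minus kin_mom_zero
  kin_mom_const_mult kin_mom_mult_const kin_mom_mult_numeral

text \<open>The form of a product of two exchange operators; it preserves singlets and
  triplets.\<close>

definition exchange_square ::
  "complex \<Rightarrow> complex \<Rightarrow> real \<Rightarrow> smooth_fun \<Rightarrow> smooth_spinor \<Rightarrow> smooth_spinor"
where
  "exchange_square c d hbar g = (\<lambda>(s, t1, t2, t3).
     let P = kin_mom hbar g; Q = kin_mom hbar (- g); v = Q 1 t1 + Q 2 t2 + Q 3 t3 in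
     (const c * (Q 1 (P 1 s) + Q 2 (P 2 s) + Q 3 (P 3 s)),
      const d * P 1 v, const d * P 2 v, const d * P 3 v))"

lemma const_diff: "const (a - b) = const a - const b"
  by (rule smooth_fun_eqI) simp

lemma spinor_scale_const_exchange_op:
  "spinor_scale (const z) (exchange_op c d hbar g \<Psi>)
    = exchange_op (z * c) (z * d) hbar g \<Psi>"
  by (cases \<Psi>) (simp add: exchange_op_def spinor_scale_def const_simps algebra_simps)

lemma spinor_scale_const_exchange_square:
  "spinor_scale (const z) (exchange_square c d hbar g \<Psi>)
    = exchange_square (z * c) (z * d) hbar g \<Psi>"
  by (cases \<Psi>) (simp add: exchange_square_def Let_def spinor_scale_def const_simps algebra_simps)

text \<open>The weights combine crosswise: a singlet passes through the triplet and returns, and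
  conversely.\<close>

lemma exchange_op_exchange_op:
  "exchange_op c d hbar g (exchange_op c' d' hbar g \<Psi>)
    = exchange_square (c * d') (d * c') hbar g \<Psi>"
  by (cases \<Psi>)
    (simp add: exchange_op_def exchange_square_def Let_def const_simps kin_mom_linear algebra_simps)

lemma exchange_square_diff:
  "exchange_square c d hbar g \<Psi> - exchange_square c' d' hbar g \<Psi>
    = exchange_square (c - c') (d - d') hbar g \<Psi>"
  by (cases \<Psi>) (simp add: exchange_square_def Let_def const_diff algebra_simps)

text \<open>With eigenvalues -3 on singlets and 1 on triplets, the weights are multiplied by -3 - 1
  and 1 - (-3).\<close>

lemma spin_spin_exchange_op_commutator:
  "spin_spin (exchange_op c d hbar g \<Psi>) - exchange_op c d hbar g (spin_spin \<Psi>)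
    = exchange_op (- 4 * c) (4 * d) hbar g \<Psi>"
  by (cases \<Psi>) (simp add: exchange_op_def spin_spin_def const_simps kin_mom_linear algebra_simps)

text \<open>K + 1 is -2 on singlets and 2 on triplets.\<close>

lemma spin_spin_exchange_square:
  "spin_spin (exchange_square c d hbar g \<Psi>) + exchange_square c d hbar g \<Psi>
    = exchange_square (- 2 * c) (2 * d) hbar g \<Psi>"
  by (cases \<Psi>) (simp add: exchange_square_def Let_def spin_spin_def const_simps algebra_simps)

lemma spin_spin_block_ham:
  "spin_spin (block_ham e a b hbar g \<Psi>)
    = block_ham e a b hbar g (spin_spin \<Psi>)"
  by (cases \<Psi>) (simp add: spin_spin_def block_ham_def Let_def kin_mom_linear algebra_simps)

text \<open>Once the components of pi and those of pi^* are each put into a fixed order, the curl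
  terms cancel by antisymmetry. What remains on both sides are the \<open>e\<close> terms and pi^* .
  pi, weighted by \<open>a\<close>.\<close>

lemma exchange_op_block_ham:
  assumes "\<And>k. pd k g = h * coord k"
  shows "exchange_op c d hbar g (block_ham e a b hbar g \<Psi>)
    = block_ham e a b hbar g (exchange_op c d hbar g \<Psi>)"
proof -
  have P: "kin_mom hbar g i (kin_mom hbar g j f) = kin_mom hbar g j (kin_mom hbar g i f)" for i j f
    using assms by (rule kin_mom_commute)
  have Q: "kin_mom hbar (- g) i (kin_mom hbar (- g) j f) = kin_mom hbar (- g) j (kin_mom hbar (- g) i f)"
    for i j f
    using assms by (intro kin_mom_commute[where h = "- h"]) simp
  show ?thesis
    by (cases \<Psi>) (simp add: exchange_op_def block_ham_def Let_def kin_mom_linear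
        P[of 2 1] P[of 3 1] P[of 3 2]
        Q[of 2 1] Q[of 3 1] Q[of 3 2] algebra_simps)
qed

section \<open>Linearity and non-vanishing\<close>

lemma spinor_linear_spin_spin: "spinor_linear spin_spin"
  unfolding spinor_linear_def by (auto simp: spin_spin_def spinor_scale_def algebra_simps)

lemma spinor_linear_exchange_op: "spinor_linear (exchange_op c d hbar g)"
  unfolding spinor_linear_def by (auto simp: exchange_op_def spinor_scale_def kin_mom_linear algebra_simps)

lemma exchange_square_nonzero:
  assumes "hbar \<noteq> 0" "c \<noteq> 0"
  shows "exchange_square c d hbar g \<noteq> (\<lambda>_. 0)"
proof
  \<comment> \<open>At the point e_1 this function and its first derivatives vanish, so only the
    second derivative contributes and the singlet value is - 2 c hbar^2, whatever \<open>g\<close>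
    is.\<close>
  define s where "s = (coord 1 - 1) * (coord 1 - 1)"
  define x :: "real ^ 3" where "x = axis 1 1"
  have x: "x \<noteq> 0" "x $ 1 = 1" "x $ 2 = 0" "x $ 3 = 0"
    by (simp_all add: x_def) (simp_all add: axis_def)
  assume "exchange_square c d hbar g = (\<lambda>_. 0)"
  then have "exchange_square c d hbar g (s, 0, 0, 0) = 0" by simp
  then have "sval (fst (exchange_square c d hbar g (s, 0, 0, 0))) x = 0" using x(1) by simp
  then show False
    using assms x by (simp add: exchange_square_def Let_def kin_mom_def s_def del: sval_simps(9))
qed

lemma exchange_op_nonzero:
  assumes "hbar \<noteq> 0" "d \<noteq> 0"
  shows "exchange_op c d hbar g \<noteq> (\<lambda>_. 0)"
proof
  assume "exchange_op c d hbar g = (\<lambda>_. 0)"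
  \<comment> \<open>Composing the zero map with \<open>exchange_op 1 d\<close> gives zero, yet the
    composite has singlet weight \<open>d\<close>.\<close>
  then have "exchange_square d (d * c) hbar g = (\<lambda>_. 0)"
    using exchange_op_exchange_op[of 1 d hbar g c d]
    by (auto simp: exchange_op_def kin_mom_linear zero_prod_def)
  with exchange_square_nonzero[OF assms] show False by blast
qed

text \<open>Handles the reversed pairs of generators in the closure condition.\<close>

lemma op_eq_comm_commute:
  "op_eq (op_comm A B) P \<Longrightarrow> op_eq (op_comm B A) (op_scale (- 1) P)"
  by (simp add: op_eq_def field_eq_def op_comm_def op_scale_def)
    (metis minus_diff_eq)

theorem proposition5:
  fixes hbar \<alpha>1 d4 d6 a :: real and f2 V0 V1 V2 V3 V4 :: "real \<Rightarrow> real"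
    and H K Y26 Y27 :: spin_op
  assumes "hbar > 0" and "d4 \<noteq> 0" and "a = 1 - 2 * \<alpha>1" and "a \<noteq> 0"
    and "smooth_on {0<..} f2"
    and "V0 = (\<lambda>r. d6 + r\<^sup>2 * (f2 r)\<^sup>2 / (2 * d4\<^sup>2)
                 - (1 + 2 * \<alpha>1) * hbar / (4 * d4) * (3 * f2 r + r * deriv f2 r))"
    and "V1 = (\<lambda>r. - (2 * \<alpha>1 * f2 r / d4))"
    and "V2 = (\<lambda>r. hbar * ((1 - 6 * \<alpha>1) * f2 r + (1 - 2 * \<alpha>1) * r * deriv f2 r) / (4 * d4))"
    and "V3 = (\<lambda>r. (2 * \<alpha>1 * r * (f2 r)\<^sup>2 - d4 * hbar * deriv f2 r) / (2 * d4\<^sup>2 * r))"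
    and "V4 = (\<lambda>r. \<alpha>1)"
    and "H = hamiltonian hbar V0 V1 V2 V3 V4"
    and "K = op_dot sigma1 sigma2"
    and "Y26 = op_scale (complex_of_real (1 / a))
               (op_dot (sigma1 - sigma2) (momentum_op hbar)
                + radial_op (\<lambda>r. f2 r / d4) \<odot> op_dot position_op (op_cross sigma1 sigma2))"
    and "Y27 = radial_op f2 \<odot> op_dot (sigma2 - sigma1) position_op
               + op_scale (complex_of_real d4) (op_dot (op_cross sigma1 sigma2) (momentum_op hbar))"
  shows "integral_of_motion H K \<and> integral_of_motion H Y26 \<and> integral_of_motion H Y27
    \<and> generate_polynomial_symmetry_algebra H {K, Y26, Y27}
    \<and> op_eq (op_comm K Y26) (op_scale (4 * \<i> / complex_of_real (a * d4)) Y27)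
    \<and> op_eq (op_comm K Y27) (op_scale (- 4 * \<i> * complex_of_real (d4 * a)) Y26)
    \<and> op_eq (op_comm Y26 Y27) (op_scale (\<i> * complex_of_real (a * d4)) ((K + id) \<odot> Y26 \<odot> Y26))
    \<and> \<not> op_eq (op_comm K Y26) 0 \<and> \<not> op_eq (op_comm K Y27) 0 \<and> \<not> op_eq (op_comm Y26 Y27) 0
    \<and> op_eq (Y27 \<odot> Y27) (op_scale (complex_of_real (d4\<^sup>2 * a\<^sup>2)) (Y26 \<odot> Y26))"
proof -
  let ?c = complex_of_real
  \<comment> \<open>The ring elements f2 / d4 and f2' / (d4 r); division by d4 is multiplication by
    a constant.\<close>
  define g where "g = const (?c (1 / d4)) * radial f2"
  define h where "h = const (?c (1 / d4)) * radial (\<lambda>r. deriv f2 r * inverse r)"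
  note d4 = \<open>d4 \<noteq> 0\<close> and a = \<open>a \<noteq> 0\<close>
  have g: "sval g x = ?c (f2 (norm x) / d4)" if "x \<noteq> 0" for x
    using that \<open>smooth_on {0<..} f2\<close> by (simp add: g_def)
  have "smooth_on {0<..} (\<lambda>r. deriv f2 r * inverse r)"
    using \<open>smooth_on {0<..} f2\<close> by (simp add: smooth_on_mult smooth_on_deriv smooth_on_inverse)
  then have h: "sval h x = ?c (deriv f2 (norm x) / (d4 * norm x))" if "x \<noteq> 0" for x
    using that by (simp add: h_def field_simps)
  have pdg: "pd k g = h * coord k" for k
    using \<open>smooth_on {0<..} f2\<close> by (simp add: g_def h_def)
  have H: "lifts H (block_ham (?c d6) (?c ((1 - 2 * \<alpha>1) / 2)) (?c ((1 + 2 * \<alpha>1) / 2)) hbar g)"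
    unfolding assms(6-11) by (rule lifts_H[OF d4 g h pdg])
  have K: "lifts K spin_spin"
    unfolding assms(12) by (rule lifts_K)
  have Y26: "lifts Y26 (exchange_op (?c (2 / a)) (?c (2 / a)) hbar g)"
    unfolding assms(13) by (rule lifts_Y26[OF d4 a g])
  have Y27: "lifts Y27 (exchange_op (2 * \<i> * ?c d4) (- 2 * \<i> * ?c d4) hbar g)"
    unfolding assms(14) by (rule lifts_Y27[OF d4 g])
  have integrals: "integral_of_motion H K" "integral_of_motion H Y26" "integral_of_motion H Y27"
    unfolding integral_of_motion_def
      op_eq_iff_lifts[OF lifts_comm[OF H K] lifts_zero]
      op_eq_iff_lifts[OF lifts_comm[OF H Y26] lifts_zero]
      op_eq_iff_lifts[OF lifts_comm[OF H Y27] lifts_zero]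
    by (simp_all add: spin_spin_block_ham exchange_op_block_ham[OF pdg]
        is_operator_lifts[OF K spinor_linear_spin_spin]
        is_operator_lifts[OF Y26 spinor_linear_exchange_op]
        is_operator_lifts[OF Y27 spinor_linear_exchange_op])
  \<comment> \<open>Both sides are exchange operators with weights - 8 / a and 8 / a.\<close>
  have KY26: "op_eq (op_comm K Y26) (op_scale (4 * \<i> / ?c (a * d4)) Y27)"
    unfolding op_eq_iff_lifts[OF lifts_comm[OF K Y26] lifts_scale[OF Y27]]
    using a d4 by (simp add: spin_spin_exchange_op_commutator spinor_scale_const_exchange_op)
  \<comment> \<open>Both weights equal - 8 i d4 on either side.\<close>
  have KY27: "op_eq (op_comm K Y27) (op_scale (- 4 * \<i> * ?c (d4 * a)) Y26)"
    unfolding op_eq_iff_lifts[OF lifts_comm[OF K Y27] lifts_scale[OF Y26]]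
    using a d4 by (simp add: spin_spin_exchange_op_commutator spinor_scale_const_exchange_op)
  \<comment> \<open>Both sides have the weights - 8 i d4 / a on singlets and 8 i d4 / a on
    triplets.\<close>
  have YY: "op_eq (op_comm Y26 Y27) (op_scale (\<i> * ?c (a * d4)) ((K + id) \<odot> Y26 \<odot> Y26))"
    unfolding op_eq_iff_lifts[OF lifts_comm[OF Y26 Y27]
      lifts_scale[OF lifts_comp[OF lifts_comp[OF lifts_add[OF K lifts_id] Y26] Y26]]]
    using a d4
    by (simp add: exchange_op_exchange_op exchange_square_diff spin_spin_exchange_square
        spinor_scale_const_exchange_square mult_ac)
  \<comment> \<open>Brings together two factors \<open>\<i>\<close> separated by another factor;
    both sides of the next identity have weights 4 d4^2.\<close>
  have "\<i> * (z * (\<i> * z)) = - (z * z)" for z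
    by (simp add: mult.left_commute[of z \<i>])
  then have sq: "op_eq (Y27 \<odot> Y27) (op_scale (?c (d4\<^sup>2 * a\<^sup>2)) (Y26 \<odot> Y26))"
    unfolding op_eq_iff_lifts[OF lifts_comp[OF Y27 Y27] lifts_scale[OF lifts_comp[OF Y26 Y26]]]
    using a d4
    by (simp add: exchange_op_exchange_op spinor_scale_const_exchange_square power2_eq_square,
        simp add: mult_ac)
  have nonzero: "\<not> op_eq (op_comm K Y26) 0" "\<not> op_eq (op_comm K Y27) 0"
    "\<not> op_eq (op_comm Y26 Y27) 0"
    unfolding op_eq_iff_lifts[OF lifts_comm[OF K Y26] lifts_zero]
      op_eq_iff_lifts[OF lifts_comm[OF K Y27] lifts_zero]
      op_eq_iff_lifts[OF lifts_comm[OF Y26 Y27] lifts_zero]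
    using a d4 \<open>hbar > 0\<close>
    by (simp_all add: spin_spin_exchange_op_commutator exchange_op_exchange_op exchange_square_diff
        exchange_op_nonzero exchange_square_nonzero)
  let ?P = "op_polynomials {K, Y26, Y27}"
  have K_P: "K \<in> ?P" and Y26_P: "Y26 \<in> ?P" and Y27_P: "Y27 \<in> ?P"
    by (simp_all add: op_polynomials.gen)
  \<comment> \<open>The zero operator is obtained as the polynomial
    \<open>op_scale 0 id\<close>.\<close>
  have self: "\<exists>P\<in>?P. op_eq (op_comm A A) P" for A
  proof (rule bexI[OF _ op_polynomials.scale[OF op_polynomials.one, of 0]])
    show "op_eq (op_comm A A) (op_scale 0 id)"
      by (simp add: op_eq_def field_eq_def op_comm_def op_scale_def)
  qed
  have both: "(\<exists>P\<in>?P. op_eq (op_comm A B) P) \<and> (\<exists>P\<in>?P. op_eq (op_comm B A) P)"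
    if "op_eq (op_comm A B) P" "P \<in> ?P" for A B P
    using that op_eq_comm_commute[OF that(1)] by (blast intro: op_polynomials.scale)
  note pairs = both[OF KY26 op_polynomials.scale[OF Y27_P]]
    both[OF KY27 op_polynomials.scale[OF Y26_P]]
    both[OF YY op_polynomials.scale[OF op_polynomials.mult[OF op_polynomials.mult[OF
      op_polynomials.add[OF K_P op_polynomials.one] Y26_P] Y26_P]]]
  have "generate_polynomial_symmetry_algebra H {K, Y26, Y27}"
    unfolding generate_polynomial_symmetry_algebra_def
    using integrals self pairs by simp
  with integrals KY26 KY27 YY nonzero sq show ?thesis by blast
qed

end
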